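(* Let $G=(V,E)$ be a hypergraph with $n$ vertices, let $A,B\subseteq V$ be disjoint, and suppose that the $A$-minimal $(A,B)$-mincut $(S,V\setminus S)$ has size $|\partial S|\le c$ and volume $\mathrm{vol}(S)=\sum_{v\in S}\deg(v)\le\nu$. Then there is an algorithm $\textsc{LocalMinCut}(A,\nu,c)$ (with access to $G$ and $B$) that finds $S$ in $O(\nu c^3\log n)$ time with high probability.
   Context: A hypergraph $G=(V,E)$ has a finite vertex set and a finite multiset of nonempty hyperedges; $\deg(v)$ is the number of hyperedges containing $v$. For $X\subseteq V$, $\partial X$ is the multiset of hyperedges meeting both $X$ and $V\setminus X$. An $(A,B)$-cut is $(X,V\setminus X)$ with $A\subseteq X$, $B\subseteq V\setminus X$, of value $|\partial X|$; an $(A,B)$-mincut has minimum value. The $A$-minimal $(A,B)$-mincut is the $(A,B)$-mincut $(X^*,V\setminus X^* )$ with $X^*\subseteq X$ for every $(A,B)$-mincut $(X,V\setminus X)$. "With high probability" means with probability at least $1-n^{-\Omega(1)}$.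
   Formalization: The running time is O(ν c^3 log n) with each factor replaced by at least 1, and ν increased by the number of isolated (degree 0) vertices of A; without this the bound can be 0 (e.g. c=0) or too small to output S ⊇ A. *)

theory Defs
  imports "HOL-Probability.Probability" "HOL-Library.Multiset"
begin

section \<open>Hypergraphs and minimum cuts\<close>

record 'a hypergraph =
  verts :: "'a set"
  hedges :: "'a set multiset"

definition wf_hypergraph :: "'a hypergraph \<Rightarrow> bool" where
  "wf_hypergraph G \<longleftrightarrow>
     finite (verts G) \<and> (\<forall>e \<in># hedges G. e \<noteq> {} \<and> e \<subseteq> verts G)"

definition deg :: "'a hypergraph \<Rightarrow> 'a \<Rightarrow> nat" where
  "deg G v = size {# e \<in># hedges G. v \<in> e #}"

definition vol :: "'a hypergraph \<Rightarrow> 'a set \<Rightarrow> nat" where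
  "vol G X = (\<Sum>v\<in>X. deg G v)"

definition boundary :: "'a hypergraph \<Rightarrow> 'a set \<Rightarrow> 'a set multiset" where
  "boundary G X = {# e \<in># hedges G. e \<inter> X \<noteq> {} \<and> e \<inter> (verts G - X) \<noteq> {} #}"

text \<open>A cut \<open>(X, V - X)\<close> is represented by its first side \<open>X\<close>.\<close>

definition is_cut :: "'a hypergraph \<Rightarrow> 'a set \<Rightarrow> 'a set \<Rightarrow> 'a set \<Rightarrow> bool" where
  "is_cut G A B X \<longleftrightarrow> X \<subseteq> verts G \<and> A \<subseteq> X \<and> B \<subseteq> verts G - X"

definition is_mincut :: "'a hypergraph \<Rightarrow> 'a set \<Rightarrow> 'a set \<Rightarrow> 'a set \<Rightarrow> bool" where
  "is_mincut G A B X \<longleftrightarrow> is_cut G A B X \<and>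
     (\<forall>Y. is_cut G A B Y \<longrightarrow> size (boundary G X) \<le> size (boundary G Y))"

definition is_minimal_mincut :: "'a hypergraph \<Rightarrow> 'a set \<Rightarrow> 'a set \<Rightarrow> 'a set \<Rightarrow> bool" where
  "is_minimal_mincut G A B S \<longleftrightarrow> is_mincut G A B S \<and>
     (\<forall>X. is_mincut G A B X \<longrightarrow> S \<subseteq> X)"


section \<open>Incidence-list access to a hypergraph\<close>

text \<open>
  Vertices are numbered from \<open>0\<close> and hyperedges are identified by their position in
  \<open>edge_lists\<close>, so parallel hyperedges have different identifiers.  The order of all
  lists is arbitrary.
\<close>

record hg_access =
  inc_lists :: "nat list list"
  edge_lists :: "nat list list"

definition represents :: "hg_access \<Rightarrow> nat hypergraph \<Rightarrow> bool" where
  "represents R G \<longleftrightarrow>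
     verts G = {..<length (inc_lists R)} \<and>
     hedges G = mset (map set (edge_lists R)) \<and>
     (\<forall>es \<in> set (edge_lists R). distinct es) \<and>
     (\<forall>v < length (inc_lists R).
        distinct (inc_lists R ! v) \<and>
        set (inc_lists R ! v) = {i. i < length (edge_lists R) \<and> v \<in> set (edge_lists R ! i)})"


section \<open>A randomized random-access machine\<close>

text \<open>
  Programs are finite syntactic objects over finitely many named arrays of natural numbers;
  a scalar is the entry at index \<open>0\<close>.  This is the unit-cost RAM with addition and
  (truncated) subtraction.  There is deliberately no multiplication, which at unit cost on
  unbounded numbers would be unrealistically powerful.  Since a program is fixed, its
  expressions have constant size, and so each of them is charged as one unit.
\<close>

datatype aexp =
    Const nat
  | Get string aexp
  | Plus aexp aexp
  | Minus aexp aexp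
  | NumVerts            \<comment> \<open>number of vertices\<close>
  | Degree aexp         \<comment> \<open>degree of a vertex\<close>
  | IncEdge aexp aexp   \<comment> \<open>vertex \<open>v\<close>, index \<open>i\<close>: the \<open>i\<close>-th hyperedge containing \<open>v\<close>\<close>
  | EdgeSize aexp       \<comment> \<open>number of vertices of a hyperedge\<close>
  | EdgeVert aexp aexp  \<comment> \<open>hyperedge \<open>e\<close>, index \<open>i\<close>: the \<open>i\<close>-th vertex of \<open>e\<close>\<close>
  | InB aexp            \<comment> \<open>\<open>1\<close> for members of \<open>B\<close>, \<open>0\<close> otherwise\<close>

datatype bexp =
    Less aexp aexp
  | Equal aexp aexp
  | Neg bexp
  | Conj bexp bexp

datatype com =
    Skip
  | Assign string aexp aexp  \<comment> \<open>\<open>x[i] := a\<close>\<close>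
  | Sample string aexp aexp  \<comment> \<open>\<open>x[i] :=\<close> uniformly random element of \<open>{0..<a}\<close>\<close>
  | Seq com com
  | IfElse bexp com com
  | While bexp com

type_synonym store = "string \<Rightarrow> nat \<Rightarrow> nat"

definition lookup :: "nat list \<Rightarrow> nat \<Rightarrow> nat" where
  "lookup xs i = (if i < length xs then xs ! i else 0)"

definition lookup_row :: "nat list list \<Rightarrow> nat \<Rightarrow> nat list" where
  "lookup_row xss i = (if i < length xss then xss ! i else [])"

primrec aval :: "hg_access \<Rightarrow> nat set \<Rightarrow> store \<Rightarrow> aexp \<Rightarrow> nat" where
  "aval R B s (Const k) = k"
| "aval R B s (Get x a) = s x (aval R B s a)"
| "aval R B s (Plus a b) = aval R B s a + aval R B s b"
| "aval R B s (Minus a b) = aval R B s a - aval R B s b"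
| "aval R B s NumVerts = length (inc_lists R)"
| "aval R B s (Degree a) = length (lookup_row (inc_lists R) (aval R B s a))"
| "aval R B s (IncEdge a b) = lookup (lookup_row (inc_lists R) (aval R B s a)) (aval R B s b)"
| "aval R B s (EdgeSize a) = length (lookup_row (edge_lists R) (aval R B s a))"
| "aval R B s (EdgeVert a b) = lookup (lookup_row (edge_lists R) (aval R B s a)) (aval R B s b)"
| "aval R B s (InB a) = (if aval R B s a \<in> B then 1 else 0)"

primrec bval :: "hg_access \<Rightarrow> nat set \<Rightarrow> store \<Rightarrow> bexp \<Rightarrow> bool" where
  "bval R B s (Less a b) \<longleftrightarrow> aval R B s a < aval R B s b"
| "bval R B s (Equal a b) \<longleftrightarrow> aval R B s a = aval R B s b"
| "bval R B s (Neg b) \<longleftrightarrow> \<not> bval R B s b"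
| "bval R B s (Conj b d) \<longleftrightarrow> bval R B s b \<and> bval R B s d"

definition store_upd :: "store \<Rightarrow> string \<Rightarrow> nat \<Rightarrow> nat \<Rightarrow> store" where
  "store_upd s x i k = s(x := (s x)(i := k))"

text \<open>
  A configuration consists of the commands still to be executed and the current store; it is
  halted when no command is left.  Every non-halted step costs one unit of time.  Sampling
  from the empty range yields \<open>0\<close>.
\<close>

type_synonym config = "com list \<times> store"

fun step :: "hg_access \<Rightarrow> nat set \<Rightarrow> config \<Rightarrow> config pmf" where
  "step R B ([], s) = return_pmf ([], s)"
| "step R B (Skip # cs, s) = return_pmf (cs, s)"
| "step R B (Assign x i a # cs, s) =
     return_pmf (cs, store_upd s x (aval R B s i) (aval R B s a))"
| "step R B (Sample x i a # cs, s) =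
     map_pmf (\<lambda>r. (cs, store_upd s x (aval R B s i) r))
       (if aval R B s a = 0 then return_pmf 0 else pmf_of_set {..<aval R B s a})"
| "step R B (Seq c d # cs, s) = return_pmf (c # d # cs, s)"
| "step R B (IfElse b c d # cs, s) = return_pmf ((if bval R B s b then c else d) # cs, s)"
| "step R B (While b c # cs, s) =
     return_pmf (if bval R B s b then c # While b c # cs else cs, s)"

primrec run :: "hg_access \<Rightarrow> nat set \<Rightarrow> nat \<Rightarrow> config \<Rightarrow> config pmf" where
  "run R B 0 cfg = return_pmf cfg"
| "run R B (Suc t) cfg = bind_pmf (step R B cfg) (run R B t)"


section \<open>Input, output and time bound\<close>

text \<open>The arguments are \<open>A\<close> (as an array \<open>xs\<close> with its length), \<open>\<nu>\<close> and \<open>c\<close>; all other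
  memory is initially zero.  The output is the set of the first \<open>lenout\<close> entries of \<open>out\<close>.\<close>

definition init_store :: "nat list \<Rightarrow> nat \<Rightarrow> nat \<Rightarrow> store" where
  "init_store xs \<nu> c = (\<lambda>x i.
     if x = ''A'' then lookup xs i
     else if x = ''lenA'' \<and> i = 0 then length xs
     else if x = ''nu'' \<and> i = 0 then \<nu>
     else if x = ''c'' \<and> i = 0 then c
     else 0)"

definition halts_with_output :: "nat set \<Rightarrow> config \<Rightarrow> bool" where
  "halts_with_output S cfg \<longleftrightarrow>
     fst cfg = [] \<and> S = snd cfg ''out'' ` {..<snd cfg ''lenout'' 0}"

definition success_prob ::
  "com \<Rightarrow> hg_access \<Rightarrow> nat set \<Rightarrow> nat list \<Rightarrow> nat \<Rightarrow> nat \<Rightarrow> nat \<Rightarrow> nat set \<Rightarrow> real" where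
  "success_prob P R B xs \<nu> c t S =
     measure_pmf.prob (run R B t ([P], init_store xs \<nu> c)) {cfg. halts_with_output S cfg}"

text \<open>
  This is exactly \<open>\<nu> * c^3 * log n\<close> if \<open>\<nu>, c \<ge> 1\<close>, \<open>n \<ge> 2\<close> and no vertex of \<open>A\<close> is isolated.
  Outside this range that product can vanish or fail to account for reading \<open>A\<close> and writing
  \<open>S \<supseteq> A\<close>, as isolated vertices do not contribute to the volume.
\<close>

definition time_bound :: "nat hypergraph \<Rightarrow> nat set \<Rightarrow> nat \<Rightarrow> nat \<Rightarrow> real" where
  "time_bound G A \<nu> c =
     real (max 1 (\<nu> + card {v \<in> A. deg G v = 0})) * real (max 1 c) ^ 3 *
     max 1 (log 2 (real (card (verts G))))"

end

theory Submission imports Defs begin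

text \<open>
  Unit flow paths are sent from \<open>A\<close> by breadth-first search in the residual hypergraph.  A search
  stops at a vertex of \<open>B\<close>; if it has logged \<open>4 (c + 1) (\<nu> + 1)\<close> vertices instead, one of these is
  drawn at random as the end of the path.  At most \<open>2 \<nu>\<close> logged vertices lie in \<open>S\<close>, because each is
  charged to an incidence of \<open>S\<close>, so all ends of a run avoid \<open>S\<close> with probability at least \<open>1/2\<close>.
  If they do, no more than \<open>|\<partial>S|\<close> paths exist, and once there are \<open>|\<partial>S|\<close> of them \<open>S\<close> is closed in the
  residual hypergraph.  Conversely, if a search exhausts a closed set \<open>X\<close> after \<open>f\<close> paths, then
  \<open>|\<partial>X|\<close> is the number of ends outside \<open>X\<close>, hence \<open>|\<partial>S| \<le> |\<partial>X| \<le> f\<close>, and \<open>f = |\<partial>S|\<close>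
  forces \<open>X = S\<close>.  So it suffices to keep the closed set with the smallest \<open>f\<close> over about
  \<open>log n\<close> runs.
\<close>

section \<open>A program logic with time and probability credits\<close>

text \<open>A search cannot tell when it leaves \<open>S\<close>, so ends are drawn blindly, and the
  log must contain few vertices of \<open>S\<close> however much the hyperedges overlap. An entry in
  \<open>S\<close> is logged either for an incidence just dealt with or as a vertex read off a
  hyperedge under expansion. Marking expanded hyperedges makes each be read at most once per search,
  so both kinds number at most \<open>vol G S\<close>; rereading a large hyperedge from each of its
  vertices would destroy this. A draw from the full log then hits \<open>S\<close> with probability
  at most \<open>1 / (2 (c + 1))\<close>, and a run makes at most \<open>c + 1\<close> draws.
  Conservation is never stated vertex by vertex: a flow is tied to its ends by its net value across
  every superset of \<open>A\<close>, which is all that the cut arguments need. The delicate point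
  is that a tree path may use one hyperedge twice, so each push has to leave intact the residual
  steps still to come. Every search is cut off, so the time budget holds for all outcomes of the
  draws. The probability is carried through the program as a credit, which replaces any argument
  about independent events.\<close>

definition win :: "hg_access \<Rightarrow> nat set \<Rightarrow> nat set \<Rightarrow> nat \<Rightarrow> config \<Rightarrow> real" where
  "win R B S t cfg = measure_pmf.prob (run R B t cfg) {cfg. halts_with_output S cfg}"

lemma win_nonneg: "0 \<le> win R B S t cfg"
  by (simp add: win_def)

lemma win_Suc_det:
  assumes "step R B cfg = return_pmf cfg'"
  shows "win R B S (Suc t) cfg = win R B S t cfg'"
  using assms by (simp add: win_def bind_return_pmf)

lemma win_halted:
  assumes "S = s ''out'' ` {..<s ''lenout'' 0}"
  shows "win R B S t ([], s) = 1"
proof -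
  have "run R B t ([], s) = return_pmf ([], s)"
    by (induction t) (simp_all add: bind_return_pmf)
  with assms show ?thesis by (simp add: win_def halts_with_output_def)
qed

lemma win_Sample:
  assumes "0 < aval R B s a"
  shows "win R B S (Suc t) (Sample x i a # cs, s) =
    (\<Sum>r<aval R B s a. win R B S t (cs, store_upd s x (aval R B s i) r)) / real (aval R B s a)"
proof -
  let ?f = "\<lambda>r. (cs, store_upd s x (aval R B s i) r)"
  have "win R B S (Suc t) (Sample x i a # cs, s) =
    measure_pmf.prob (bind_pmf (pmf_of_set {..<aval R B s a}) (\<lambda>r. run R B t (?f r)))
      {cfg. halts_with_output S cfg}"
    using assms by (simp add: win_def bind_map_pmf)
  also have "\<dots> = measure_pmf.expectation (pmf_of_set {..<aval R B s a})
      (\<lambda>r. win R B S t (?f r))"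
    unfolding win_def measure_pmf_bind
    by (subst measure_pmf.measure_bind[where N = "count_space UNIV"])
      (auto simp: space_subprob_algebra measure_pmf.subprob_space_axioms)
  also have "\<dots> = (\<Sum>r<aval R B s a. win R B S t (?f r)) / real (aval R B s a)"
    using assms by (subst integral_pmf_of_set) (auto simp: lessThan_empty_iff)
  finally show ?thesis .
qed

text \<open>An assertion sees, besides the store, the remaining time \<open>t\<close> and a lower bound \<open>p\<close> on the
  success probability that still has to be guaranteed.\<close>

type_synonym assn = "store \<Rightarrow> nat \<Rightarrow> real \<Rightarrow> bool"

text \<open>Only later moments \<open>t' < t\<close> are considered: this is what makes wp_While sound.\<close>

definition wp :: "hg_access \<Rightarrow> nat set \<Rightarrow> nat set \<Rightarrow> com \<Rightarrow> assn \<Rightarrow> assn" where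
  "wp R B S c Q s t p \<longleftrightarrow> (\<forall>cs. (\<forall>s' t' p'. t' < t \<longrightarrow> Q s' t' p' \<longrightarrow> p' \<le> win R B S t' (cs, s')) \<longrightarrow>
     p \<le> win R B S t (c # cs, s))"

lemma wp_mono:
  assumes "wp R B S c Q s t p" "\<And>s' t' p'. t' < t \<Longrightarrow> Q s' t' p' \<Longrightarrow> Q' s' t' p'"
  shows "wp R B S c Q' s t p"
  using assms unfolding wp_def by blast

text \<open>The remaining time is the variant, so none has to be supplied. The price is that
  \<open>I\<close> must imply \<open>0 < t\<close>: a loop invariant has to contain its own time
  budget.\<close>

lemma wp_While:
  assumes inv: "I s t p"
    and step: "\<And>s t p. I s t p \<Longrightarrow> 0 < t \<and>
      (if bval R B s b then wp R B S c I s (t - 1) p else Q s (t - 1) p)"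
  shows "wp R B S (While b c) Q s t p"
  unfolding wp_def
proof (intro allI impI)
  fix cs assume "\<forall>s' t' p'. t' < t \<longrightarrow> Q s' t' p' \<longrightarrow> p' \<le> win R B S t' (cs, s')"
  then show "p \<le> win R B S t (While b c # cs, s)"
    using inv
  proof (induction t arbitrary: s p rule: less_induct)
    case (less t)
    from step[OF less.prems(2)] obtain t' where t: "t = Suc t'" by (cases t) auto
    show ?case
    proof (cases "bval R B s b")
      case True
      with step[OF less.prems(2)] t have "wp R B S c I s t' p" by simp
      moreover have "p'' \<le> win R B S t'' (While b c # cs, s'')"
        if "t'' < t'" "I s'' t'' p''" for s'' t'' p''
        using less.IH[of t'' s'' p''] less.prems(1) that t by auto
      ultimately have "p \<le> win R B S t' (c # While b c # cs, s)"
        unfolding wp_def by blast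
      with True t show ?thesis by (simp add: win_Suc_det)
    next
      case False
      with step[OF less.prems(2)] t less.prems(1) show ?thesis
        by (simp add: win_Suc_det)
    qed
  qed
qed

lemma wp_Skip: "0 < t \<Longrightarrow> Q s (t - 1) p \<Longrightarrow> wp R B S Skip Q s t p"
  by (cases t) (auto simp: wp_def win_Suc_det)

lemma wp_Assign:
  "0 < t \<Longrightarrow> Q (store_upd s x (aval R B s i) (aval R B s a)) (t - 1) p \<Longrightarrow>
    wp R B S (Assign x i a) Q s t p"
  by (cases t) (auto simp: wp_def win_Suc_det)

text \<open>Credit can be redistributed here: an outcome may be promised less than \<open>p\<close>
  as long as the average over the range is at least \<open>p\<close>.\<close>

lemma wp_Sample:
  assumes "0 < t" and M: "0 < aval R B s a"
    and g: "p \<le> (\<Sum>r<aval R B s a. g r) / real (aval R B s a)"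
    and Q: "\<And>r. r < aval R B s a \<Longrightarrow> Q (store_upd s x (aval R B s i) r) (t - 1) (g r)"
  shows "wp R B S (Sample x i a) Q s t p"
  unfolding wp_def
proof (intro allI impI)
  let ?M = "aval R B s a"
  obtain t' where t: "t = Suc t'" using assms(1) by (cases t) auto
  fix cs assume *: "\<forall>s' t' p'. t' < t \<longrightarrow> Q s' t' p' \<longrightarrow> p' \<le> win R B S t' (cs, s')"
  have "(\<Sum>r<?M. g r) \<le> (\<Sum>r<?M. win R B S t' (cs, store_upd s x (aval R B s i) r))"
    using * t Q by (intro sum_mono) auto
  with g M show "p \<le> win R B S t (Sample x i a # cs, s)"
    unfolding t by (subst win_Sample) (auto elim!: order.trans intro: divide_right_mono)
qed

lemma wp_Seq:
  assumes "0 < t" "wp R B S c (wp R B S d Q) s (t - 1) p"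
  shows "wp R B S (Seq c d) Q s t p"
  unfolding wp_def
proof (intro allI impI)
  obtain t' where t: "t = Suc t'" using assms(1) by (cases t) auto
  fix cs assume *: "\<forall>s' t' p'. t' < t \<longrightarrow> Q s' t' p' \<longrightarrow> p' \<le> win R B S t' (cs, s')"
  have "\<forall>s'' t'' p''. t'' < t' \<longrightarrow> wp R B S d Q s'' t'' p'' \<longrightarrow>
      p'' \<le> win R B S t'' (d # cs, s'')"
  proof (intro allI impI)
    fix s'' t'' p'' assume "t'' < t'" "wp R B S d Q s'' t'' p''"
    then show "p'' \<le> win R B S t'' (d # cs, s'')"
      using * t unfolding wp_def by auto
  qed
  with assms(2) t have "p \<le> win R B S t' (c # d # cs, s)" unfolding wp_def by simp
  then show "p \<le> win R B S t (Seq c d # cs, s)" by (simp add: t win_Suc_det)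
qed

lemma wp_IfElse:
  assumes "0 < t" "wp R B S (if bval R B s b then c else d) Q s (t - 1) p"
  shows "wp R B S (IfElse b c d) Q s t p"
  using assms by (cases t) (auto simp: wp_def win_Suc_det)

section \<open>Commands that preserve the credit\<close>

text \<open>Quantifying over \<open>Q\<close> and \<open>p\<close> yields a specification that fits
  into any \<open>wp\<close> goal: the credit passes through unchanged and at most \<open>T\<close>
  units of time are lost.\<close>

definition runs ::
  "hg_access \<Rightarrow> nat set \<Rightarrow> nat set \<Rightarrow> com \<Rightarrow> store \<Rightarrow> nat \<Rightarrow> (store \<Rightarrow> bool) \<Rightarrow> bool" where
  "runs R B S c s T post \<longleftrightarrow> (\<forall>t p Q. T \<le> t \<longrightarrow>
     (\<forall>s' t'. post s' \<longrightarrow> t \<le> t' + T \<longrightarrow> Q s' t' p) \<longrightarrow> wp R B S c Q s t p)"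

lemma runs_wp:
  assumes "runs R B S c s T post" "T \<le> t" "\<And>s' t'. post s' \<Longrightarrow> t \<le> t' + T \<Longrightarrow> Q s' t' p"
  shows "wp R B S c Q s t p"
  using assms unfolding runs_def by blast

lemma runs_mono:
  assumes "runs R B S c s T post" "T \<le> T'" "\<And>s'. post s' \<Longrightarrow> post' s'"
  shows "runs R B S c s T' post'"
  unfolding runs_def
proof (intro allI impI)
  fix t p and Q :: assn assume "T' \<le> t" "\<forall>s' t'. post' s' \<longrightarrow> t \<le> t' + T' \<longrightarrow> Q s' t' p"
  then show "wp R B S c Q s t p"
    by (intro runs_wp[OF assms(1)]) (use assms(2,3) in auto)
qed

lemma runs_Seq:
  assumes c: "runs R B S c s T1 P1" and d: "\<And>s'. P1 s' \<Longrightarrow> runs R B S d s' T2 P2"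
  shows "runs R B S (Seq c d) s (Suc (T1 + T2)) P2"
  unfolding runs_def
proof (intro allI impI)
  fix t p and Q :: assn assume t: "Suc (T1 + T2) \<le> t"
    and Q: "\<forall>s' t'. P2 s' \<longrightarrow> t \<le> t' + Suc (T1 + T2) \<longrightarrow> Q s' t' p"
  show "wp R B S (Seq c d) Q s t p"
  proof (rule wp_Seq)
    show "wp R B S c (wp R B S d Q) s (t - 1) p"
    proof (rule runs_wp[OF c])
      fix s' t' assume "P1 s'" "t - 1 \<le> t' + T1"
      with t Q show "wp R B S d Q s' t' p"
        by (intro runs_wp[OF d]) auto
    qed (use t in auto)
  qed (use t in auto)
qed

text \<open>The index of \<open>I\<close> bounds the remaining iterations. Each costs
  \<open>C\<close> plus one unit for the test, and the surplus in \<open>Suc i\<close> pays for the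
  final failing test.\<close>

lemma runs_While:
  assumes body: "\<And>i s. I i s \<Longrightarrow> bval R B s b \<Longrightarrow> runs R B S c s C (\<lambda>s'. \<exists>i'<i. I i' s')"
    and init: "I i s"
  shows "runs R B S (While b c) s (Suc C * Suc i) (\<lambda>s'. \<exists>i. I i s' \<and> \<not> bval R B s' b)"
  unfolding runs_def
proof (intro allI impI)
  fix t p and Q :: assn assume t: "Suc C * Suc i \<le> t"
    and Q: "\<forall>s' t'. (\<exists>i. I i s' \<and> \<not> bval R B s' b) \<longrightarrow> t \<le> t' + Suc C * Suc i \<longrightarrow> Q s' t' p"
  let ?T = "Suc C * Suc i"
  let ?I = "\<lambda>s t' p'. p' = p \<and> (\<exists>i. I i s \<and> t + Suc C * Suc i \<le> t' + ?T)"
  show "wp R B S (While b c) Q s t p"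
  proof (rule wp_While[where I = ?I])
    show "?I s t p" using init by auto
  next
    fix s t' p' assume "?I s t' p'"
    then obtain i' where p': "p' = p" and i': "I i' s" and t': "t + Suc C * Suc i' \<le> t' + ?T"
      by blast
    have t'C: "Suc C * Suc i' \<le> t'" using t t' by linarith
    have pos: "0 < t'" using t'C by (cases t') auto
    have "wp R B S c ?I s (t' - 1) p'" if "bval R B s b"
    proof (rule runs_wp[OF body[OF i' that]])
      show "C \<le> t' - 1" using t'C by simp
      fix s'' t'' assume "\<exists>i''<i'. I i'' s''" and t'': "t' - 1 \<le> t'' + C"
      then obtain i'' where i'': "i'' < i'" "I i'' s''" by blast
      have "Suc C * Suc i'' + Suc C \<le> Suc C * Suc i'"
        using i''(1) by (metis Suc_leI add.commute mult_Suc_right mult_le_mono2 Suc_le_mono)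
      then show "?I s'' t'' p'" using i'' t' t'' p' pos by auto
    qed
    moreover have "Q s (t' - 1) p'" if "\<not> bval R B s b"
      using Q i' that t' p' pos by auto
    ultimately show "0 < t' \<and> (if bval R B s b then wp R B S c ?I s (t' - 1) p' else Q s (t' - 1) p')"
      using pos by auto
  qed
qed

section \<open>Straight-line code\<close>

primrec straight :: "com \<Rightarrow> bool" where
  "straight Skip = True"
| "straight (Assign x i a) = True"
| "straight (Sample x i a) = False"
| "straight (Seq c d) = (straight c \<and> straight d)"
| "straight (IfElse b c d) = (straight c \<and> straight d)"
| "straight (While b c) = False"

primrec cost :: "com \<Rightarrow> nat" where
  "cost Skip = 1"
| "cost (Assign x i a) = 1"
| "cost (Sample x i a) = 1"
| "cost (Seq c d) = Suc (cost c + cost d)"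
| "cost (IfElse b c d) = Suc (max (cost c) (cost d))"
| "cost (While b c) = 0"

text \<open>Only meaningful for straight-line commands.\<close>

primrec ev :: "hg_access \<Rightarrow> nat set \<Rightarrow> com \<Rightarrow> store \<Rightarrow> store" where
  "ev R B Skip s = s"
| "ev R B (Assign x i a) s = store_upd s x (aval R B s i) (aval R B s a)"
| "ev R B (Sample x i a) s = s"
| "ev R B (Seq c d) s = ev R B d (ev R B c s)"
| "ev R B (IfElse b c d) s = (if bval R B s b then ev R B c s else ev R B d s)"
| "ev R B (While b c) s = s"

lemma runs_straight: "straight c \<Longrightarrow> runs R B S c s (cost c) (\<lambda>s'. s' = ev R B c s)"
proof (induction c arbitrary: s)
  case Skip
  then show ?case by (auto simp: runs_def intro: wp_Skip)
next
  case (Assign x i a)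
  then show ?case by (auto simp: runs_def intro: wp_Assign)
next
  case (Seq c d)
  have "runs R B S (Seq c d) s (Suc (cost c + cost d)) (\<lambda>s'. s' = ev R B d (ev R B c s))"
    using Seq by (intro runs_Seq[where ?P1.0 = "\<lambda>s'. s' = ev R B c s"]) auto
  then show ?case by simp
next
  case (IfElse b c d)
  let ?c = "if bval R B s b then c else d"
  have *: "runs R B S ?c s (max (cost c) (cost d)) (\<lambda>s'. s' = ev R B ?c s)"
    using IfElse.prems by (auto intro: runs_mono[OF IfElse.IH(1)] runs_mono[OF IfElse.IH(2)])
  show ?case unfolding runs_def
  proof (intro allI impI, rule wp_IfElse)
    fix t p and Q :: assn assume t: "cost (IfElse b c d) \<le> t"
      and Q: "\<forall>s' t'. s' = ev R B (IfElse b c d) s \<longrightarrow> t \<le> t' + cost (IfElse b c d) \<longrightarrow> Q s' t' p"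
    show "wp R B S ?c Q s (t - 1) p"
      by (rule runs_wp[OF *]) (use t Q in auto)
  qed auto
qed auto

lemma runs_ev:
  assumes "straight c" "cost c \<le> T" "post (ev R B c s)"
  shows "runs R B S c s T post"
  using runs_straight[OF assms(1)] by (rule runs_mono) (use assms in auto)

text \<open>Keeping the final store as a variable allows its arrays to be described one by one,
  instead of carrying nested updates into an invariant.\<close>

lemma runs_evI:
  assumes "straight c" "cost c \<le> T" "\<And>s'. s' = ev R B c s \<Longrightarrow> post s'"
  shows "runs R B S c s T post"
  using assms by (intro runs_ev) auto


section \<open>Unit flows in hypergraphs\<close>

text \<open>\<open>F e = Some (u, w)\<close> means that the hyperedge \<open>e\<close> carries one unit of flow that enters it
  at \<open>u\<close> and leaves it at \<open>w\<close>.  Then only \<open>w\<close> can redirect the unit to an arbitrary vertex of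
  \<open>e\<close>, whereas any other vertex can only take over the role of \<open>u\<close>.\<close>

type_synonym flow = "nat \<Rightarrow> (nat \<times> nat) option"

definition trav :: "flow \<Rightarrow> nat \<Rightarrow> nat \<Rightarrow> nat \<Rightarrow> bool" where
  "trav F v e x \<longleftrightarrow> (case F e of None \<Rightarrow> True | Some (u, w) \<Rightarrow> w = v \<or> x = u)"

text \<open>In the last case \<open>x\<close> is absent from the result because \<open>trav\<close>
  forces \<open>x = u\<close>: the unit that entered at \<open>x\<close> now enters at
  \<open>v\<close>.\<close>

definition push :: "flow \<Rightarrow> nat \<Rightarrow> nat \<Rightarrow> nat \<Rightarrow> flow" where
  "push F v e x = F(e := Some (case F e of None \<Rightarrow> (v, x)
     | Some (u, w) \<Rightarrow> if w = v then (u, x) else (v, w)))"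

locale access =
  fixes G :: "nat hypergraph" and R :: hg_access
  assumes wf: "wf_hypergraph G" and rep: "represents R G"
begin

abbreviation "n \<equiv> length (inc_lists R)"
abbreviation "m \<equiv> length (edge_lists R)"
abbreviation "dg v \<equiv> length (lookup_row (inc_lists R) v)"
abbreviation "inc v j \<equiv> lookup (lookup_row (inc_lists R) v) j"
abbreviation "el e \<equiv> lookup_row (edge_lists R) e"
abbreviation "ed e \<equiv> set (lookup_row (edge_lists R) e)"

section \<open>Incidence lists against hyperedges\<close>

lemma verts_eq: "verts G = {..<n}"
  using rep by (simp add: represents_def)

lemma hedges_eq: "hedges G = image_mset ed (mset_set {..<m})"
proof -
  have "hedges G = mset (map set (edge_lists R))"
    using rep by (simp add: represents_def)
  also have "map set (edge_lists R) = map ed [0..<m]"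
    by (intro nth_equalityI) (auto simp: lookup_row_def)
  finally show ?thesis
    by (simp add: mset_map atLeast0LessThan)
qed

lemma ed_subset: "e < m \<Longrightarrow> ed e \<subseteq> {..<n}"
  using wf by (auto simp: wf_hypergraph_def verts_eq hedges_eq)

lemma distinct_el: "e < m \<Longrightarrow> distinct (el e)"
  using rep by (auto simp: represents_def lookup_row_def)

lemma inc_list: "v < n \<Longrightarrow> distinct (lookup_row (inc_lists R) v) \<and>
    set (lookup_row (inc_lists R) v) = {e. e < m \<and> v \<in> ed e}"
  using rep by (auto simp: represents_def lookup_row_def)

lemma inc_edge:
  assumes "v < n" "j < dg v"
  shows "inc v j < m" "v \<in> ed (inc v j)"
  using nth_mem[OF assms(2)] assms inc_list[OF assms(1)] by (auto simp: lookup_def)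

lemma edge_inc:
  assumes "e < m" "v \<in> ed e"
  obtains j where "j < dg v" "inc v j = e"
proof -
  have "v < n" using assms ed_subset by auto
  then have "e \<in> set (lookup_row (inc_lists R) v)" using inc_list assms by auto
  then show ?thesis using that by (auto simp: in_set_conv_nth lookup_def)
qed

lemma size_filter_hedges: "size (filter_mset P (hedges G)) = (\<Sum>e<m. of_bool (P (ed e)))"
proof -
  have "size (filter_mset P (hedges G)) = card ({..<m} \<inter> {e. P (ed e)})"
    by (simp add: hedges_eq filter_mset_image_mset Int_def)
  then show ?thesis by simp
qed

lemma deg_eq: "deg G v = (\<Sum>e<m. of_bool (v \<in> ed e))"
  by (simp add: deg_def size_filter_hedges)

lemma dg_eq_deg:
  assumes "v < n" shows "dg v = deg G v"
proof -
  have "dg v = card {e. e < m \<and> v \<in> ed e}"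
    using inc_list[OF assms] by (metis distinct_card)
  also have "{e. e < m \<and> v \<in> ed e} = {..<m} \<inter> {e. v \<in> ed e}" by auto
  finally show ?thesis by (simp add: deg_eq)
qed

text \<open>Double counting of incidences. Both views of the volume are needed: scanned incidences
  are counted at vertices, entries of expanded hyperedges at hyperedges.\<close>

lemma vol_eq: "finite X \<Longrightarrow> vol G X = (\<Sum>e<m. length (filter (\<lambda>x. x \<in> X) (el e)))"
proof -
  assume X: "finite X"
  have *: "length (filter (\<lambda>x. x \<in> X) (el e)) = (\<Sum>v\<in>X. of_bool (v \<in> ed e))" if "e < m" for e
  proof -
    have "length (filter (\<lambda>x. x \<in> X) (el e)) = card (ed e \<inter> X)"
      using distinct_el[OF that]
      by (metis distinct_card distinct_filter set_filter Int_def Collect_mem_eq)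
    also have "ed e \<inter> X = X \<inter> {v. v \<in> ed e}" by auto
    finally show ?thesis using X by simp
  qed
  have "vol G X = (\<Sum>e<m. \<Sum>v\<in>X. of_bool (v \<in> ed e))"
    unfolding vol_def deg_eq by (rule sum.swap)
  then show ?thesis using * by simp
qed

section \<open>Cut values and net flow\<close>

definition crosses :: "nat set \<Rightarrow> nat \<Rightarrow> bool" where
  "crosses X e \<longleftrightarrow> ed e \<inter> X \<noteq> {} \<and> ed e \<inter> (verts G - X) \<noteq> {}"

lemma size_boundary: "int (size (boundary G X)) = (\<Sum>e<m. of_bool (crosses X e))"
  by (simp add: boundary_def size_filter_hedges crosses_def)

definition outflow :: "nat set \<Rightarrow> flow \<Rightarrow> nat \<Rightarrow> int" where
  "outflow X F e = (case F e of None \<Rightarrow> 0 | Some (u, w) \<Rightarrow> of_bool (u \<in> X) - of_bool (w \<in> X))"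

definition net :: "nat set \<Rightarrow> flow \<Rightarrow> int" where
  "net X F = (\<Sum>e<m. outflow X F e)"

definition valid_flow :: "flow \<Rightarrow> bool" where
  "valid_flow F \<longleftrightarrow> (\<forall>e<m. \<forall>u w. F e = Some (u, w) \<longrightarrow> u \<in> ed e \<and> w \<in> ed e)"

definition tedge :: "flow \<Rightarrow> nat \<Rightarrow> nat \<Rightarrow> nat \<Rightarrow> bool" where
  "tedge F v e x \<longleftrightarrow> e < m \<and> v \<in> ed e \<and> x \<in> ed e \<and> trav F v e x"

definition closed_set :: "flow \<Rightarrow> nat set \<Rightarrow> bool" where
  "closed_set F X \<longleftrightarrow> (\<forall>v\<in>X. \<forall>e x. tedge F v e x \<longrightarrow> x \<in> X)"

lemma valid_push: "valid_flow F \<Longrightarrow> tedge F v e x \<Longrightarrow> valid_flow (push F v e x)"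
  by (auto simp: valid_flow_def push_def tedge_def split: option.splits)

text \<open>Creating a unit, moving its exit from \<open>v\<close> to \<open>x\<close>, and moving
  its entry from \<open>x\<close> to \<open>v\<close> all change the net value by the same amount.
  Hence the changes along a path telescope.\<close>

lemma net_push:
  assumes "tedge F v e x"
  shows "net X (push F v e x) = net X F + of_bool (v \<in> X) - of_bool (x \<in> X)"
proof -
  have e: "e < m" using assms by (simp add: tedge_def)
  have "net X (push F v e x) - net X F = (\<Sum>e'<m. outflow X (push F v e x) e' - outflow X F e')"
    by (simp add: net_def sum_subtractf)
  also have "\<dots> = (\<Sum>e'<m. if e' = e then of_bool (v \<in> X) - of_bool (x \<in> X) else 0)"
    using assms
    by (intro sum.cong) (auto simp: outflow_def push_def trav_def tedge_def split: option.splits)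
  finally show ?thesis using e by simp
qed

lemma outflow_le:
  assumes "valid_flow F" "e < m"
  shows "outflow X F e \<le> of_bool (crosses X e)"
proof (cases "F e")
  case (Some p)
  obtain u w where p: "p = (u, w)" by (cases p)
  have "u \<in> ed e" "w \<in> ed e" using assms Some p unfolding valid_flow_def by blast+
  then have "crosses X e" if "u \<in> X" "w \<notin> X"
    using that ed_subset[OF assms(2)] by (auto simp: crosses_def verts_eq)
  then show ?thesis using Some p by (auto simp: outflow_def)
qed (simp add: outflow_def)

lemma net_le_boundary: "valid_flow F \<Longrightarrow> net X F \<le> int (size (boundary G X))"
  unfolding net_def size_boundary by (intro sum_mono outflow_le) auto

text \<open>Saturation forces every crossing hyperedge to carry a unit that enters inside
  \<open>X\<close> and exits outside. A residual step out of \<open>X\<close> would have to start at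
  that exit or end at that entry, and both are on the wrong side.\<close>

lemma saturated_closed:
  assumes F: "valid_flow F" and sat: "int (size (boundary G X)) \<le> net X F"
  shows "closed_set F X"
  unfolding closed_set_def
proof (intro ballI allI impI)
  fix v e x assume v: "v \<in> X" and t: "tedge F v e x"
  then have e: "e < m" "v \<in> ed e" "x \<in> ed e" by (auto simp: tedge_def)
  show "x \<in> X"
  proof (rule ccontr)
    assume x: "x \<notin> X"
    then have "crosses X e" using v e ed_subset[of e] by (auto simp: crosses_def verts_eq)
    moreover have "outflow X F e = of_bool (crosses X e)"
    proof (rule ccontr)
      assume "outflow X F e \<noteq> of_bool (crosses X e)"
      then have "net X F < int (size (boundary G X))"
        unfolding net_def size_boundary
        using outflow_le[OF F] e(1) by (intro sum_strict_mono_ex1 bexI[of _ e]) (auto simp: less_le)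
      with sat show False by simp
    qed
    ultimately show False
      using t v x by (auto simp: outflow_def tedge_def trav_def of_bool_def split: option.splits if_splits)
  qed
qed

text \<open>A crossing hyperedge without a residual step out of \<open>X\<close> must carry a unit.
  Its entry is reachable from every vertex of the hyperedge, hence inside; its exit is outside,
  because an exit inside would reach everything.\<close>

lemma net_closed:
  assumes F: "valid_flow F" and cl: "closed_set F X"
  shows "net X F = int (size (boundary G X))"
  unfolding net_def size_boundary
proof (intro sum.cong refl)
  fix e assume "e \<in> {..<m}"
  then have e: "e < m" by simp
  show "outflow X F e = of_bool (crosses X e)"
  proof (cases "crosses X e")
    case True
    then obtain v x where vx: "v \<in> ed e" "v \<in> X" "x \<in> ed e" "x \<notin> X"
      by (auto simp: crosses_def)
    have no: "\<not> trav F v e x" using cl vx e by (auto simp: closed_set_def tedge_def)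
    then obtain u w where F_e: "F e = Some (u, w)" by (auto simp: trav_def split: option.splits)
    have uw: "u \<in> ed e" "w \<in> ed e" using F F_e e by (auto simp: valid_flow_def)
    have "tedge F v e u" using vx e uw F_e by (simp add: tedge_def trav_def)
    then have "u \<in> X" using cl vx unfolding closed_set_def by blast
    moreover have "w \<notin> X"
    proof
      assume "w \<in> X"
      then have "x \<in> X" using cl vx e uw F_e unfolding closed_set_def tedge_def trav_def by force
      with vx show False by simp
    qed
    ultimately show ?thesis using True F_e by (simp add: outflow_def)
  next
    case False
    have "(u \<in> X) = (w \<in> X)" if "F e = Some (u, w)" for u w
    proof -
      have "u \<in> ed e" "w \<in> ed e" using that F e unfolding valid_flow_def by blast+
      then show ?thesis using ed_subset[OF e] False by (auto simp: crosses_def verts_eq)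
    qed
    then show ?thesis using False by (auto simp: outflow_def split: option.splits)
  qed
qed

end


section \<open>Local minimum cuts\<close>

locale local_cut = access +
  fixes A B S :: "nat set" and xs :: "nat list" and \<nu> c :: nat
  assumes AG: "A \<subseteq> verts G" and BG: "B \<subseteq> verts G" and AB: "A \<inter> B = {}"
    and xs: "distinct xs" "set xs = A"
    and mincut: "is_minimal_mincut G A B S"
    and bd: "size (boundary G S) \<le> c" and vol: "vol G S \<le> \<nu>"
begin

abbreviation "\<kappa> \<equiv> size (boundary G S)"

lemma S_props: "A \<subseteq> S" "S \<inter> B = {}" "S \<subseteq> {..<n}" "finite S"
  using mincut by (auto simp: is_minimal_mincut_def is_mincut_def is_cut_def verts_eq
    intro: finite_subset[of _ "{..<n}"])

lemma is_cutI: "X \<subseteq> {..<n} \<Longrightarrow> A \<subseteq> X \<Longrightarrow> X \<inter> B = {} \<Longrightarrow> is_cut G A B X"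
  using BG by (auto simp: is_cut_def verts_eq)

text \<open>Conservation in aggregate form: the sources lie inside every such \<open>X\<close>, so
  only the ends outside count, with multiplicity. An end in \<open>A\<close>, which a draw may
  produce, contributes to no \<open>X\<close>.\<close>

definition flow_ends :: "flow \<Rightarrow> nat list \<Rightarrow> bool" where
  "flow_ends F ts \<longleftrightarrow> valid_flow F \<and>
     (\<forall>X. A \<subseteq> X \<longrightarrow> net X F = int (length (filter (\<lambda>x. x \<notin> X) ts)))"

lemma flow_ends_empty: "flow_ends (\<lambda>_. None) []"
  by (simp add: flow_ends_def valid_flow_def net_def outflow_def)

lemma good_ends_le: "flow_ends F ts \<Longrightarrow> set ts \<inter> S = {} \<Longrightarrow> length ts \<le> \<kappa>"
proof -
  assume F: "flow_ends F ts" and ts: "set ts \<inter> S = {}"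
  have "filter (\<lambda>x. x \<notin> S) ts = ts" using ts by (auto simp: filter_id_conv)
  then have "int (length ts) = net S F" using F S_props by (simp add: flow_ends_def)
  also have "\<dots> \<le> int \<kappa>" using F by (intro net_le_boundary) (simp add: flow_ends_def)
  finally show ?thesis by simp
qed

text \<open>Nothing is assumed about where the ends lie, so even a run with ends in \<open>S\<close>
  cannot output a set after fewer than \<open>\<kappa>\<close> paths. In the case of equality
  \<open>X\<close> is a mincut that contains no end; by minimality \<open>S \<subseteq> X\<close>,
  so \<open>S\<close> contains none either and is saturated.\<close>

lemma closed_ge:
  assumes F: "flow_ends F ts" and X: "X \<subseteq> {..<n}" "A \<subseteq> X" "X \<inter> B = {}" and cl: "closed_set F X"
  shows "\<kappa> \<le> length ts"
    and "length ts = \<kappa> \<Longrightarrow> S \<subseteq> X \<and> closed_set F S"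
proof -
  have "\<kappa> \<le> size (boundary G X)"
    using mincut is_cutI[OF X] by (auto simp: is_minimal_mincut_def is_mincut_def)
  moreover have *: "int (size (boundary G X)) = int (length (filter (\<lambda>x. x \<notin> X) ts))"
    using F X cl net_closed[of F X] by (simp add: flow_ends_def)
  moreover have **: "length (filter (\<lambda>x. x \<notin> X) ts) \<le> length ts" by simp
  ultimately show "\<kappa> \<le> length ts" by linarith
  assume eq: "length ts = \<kappa>"
  have "size (boundary G X) = \<kappa>"
    using * ** eq \<open>\<kappa> \<le> size (boundary G X)\<close> by linarith
  then have "is_mincut G A B X"
    using mincut is_cutI[OF X] by (auto simp: is_minimal_mincut_def is_mincut_def)
  then have SX: "S \<subseteq> X" using mincut by (auto simp: is_minimal_mincut_def)
  have "length (filter (\<lambda>x. x \<notin> X) ts) = length ts"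
    using * ** eq \<open>\<kappa> \<le> size (boundary G X)\<close> by linarith
  then have "\<forall>x\<in>set ts. x \<notin> X"
    by (metis length_filter_less linorder_neq_iff)
  then have "filter (\<lambda>x. x \<notin> S) ts = ts" using SX by (auto simp: filter_id_conv)
  then have "net S F = int \<kappa>" using F eq S_props by (simp add: flow_ends_def)
  then have "closed_set F S" using F by (intro saturated_closed) (auto simp: flow_ends_def)
  with SX show "S \<subseteq> X \<and> closed_set F S" by simp
qed

end


section \<open>Breadth-first search in the residual hypergraph\<close>

context local_cut
begin

text \<open>The queue is \<open>q 0, \<dots>, q (qn - 1)\<close>; \<open>pv x\<close> and \<open>pe x\<close> are the vertex and the hyperedge from
  which \<open>x\<close> was reached, with \<open>pv x = x\<close> at roots.  A tree path may use a hyperedge twice: first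
  to take over its tail, later to redirect its head.  The last condition says that nothing else
  can happen.\<close>

definition search_tree ::
  "flow \<Rightarrow> (nat \<Rightarrow> nat) \<Rightarrow> nat \<Rightarrow> (nat \<Rightarrow> nat) \<Rightarrow> (nat \<Rightarrow> nat) \<Rightarrow> bool" where
  "search_tree F q qn pv pe \<longleftrightarrow> inj_on q {..<qn} \<and> q ` {..<qn} \<subseteq> {..<n} \<and>
     (\<forall>i<qn. q i \<in> A \<and> pv (q i) = q i \<or>
        (\<exists>i'<i. pv (q i) = q i' \<and> tedge F (q i') (pe (q i)) (q i))) \<and>
     (\<forall>i i' i''. i < qn \<longrightarrow> i'' < i \<longrightarrow> i' \<le> i'' \<longrightarrow> pv (q i) = q i'' \<longrightarrow> pv (q i') \<noteq> q i' \<longrightarrow>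
        pe (q i) = pe (q i') \<longrightarrow> F (pe (q i)) = Some (q i', q i''))"

definition scanned :: "flow \<Rightarrow> nat set \<Rightarrow> nat \<Rightarrow> nat \<Rightarrow> bool" where
  "scanned F V v e \<longleftrightarrow> (\<forall>x\<in>ed e. trav F v e x \<longrightarrow> x \<in> V)"

definition explored :: "flow \<Rightarrow> (nat \<Rightarrow> nat) \<Rightarrow> nat \<Rightarrow> nat \<Rightarrow> nat \<Rightarrow> bool" where
  "explored F q qn qh j \<longleftrightarrow> qh \<le> qn \<and>
     (\<forall>i<qh. \<forall>j'<dg (q i). scanned F (q ` {..<qn}) (q i) (inc (q i) j')) \<and>
     (if qh < qn then j \<le> dg (q qh) \<and> (\<forall>j'<j. scanned F (q ` {..<qn}) (q qh) (inc (q qh) j'))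
      else j = 0)"

text \<open>An expansion is spread over several steps, one vertex each. A nonzero \<open>l\<close>
  must therefore belong to the current incidence and to a hyperedge that is freely traversable from
  the current vertex; otherwise the next step would take another branch and \<open>l\<close> would
  be stale.\<close>

definition expanding ::
  "flow \<Rightarrow> nat \<Rightarrow> (nat \<Rightarrow> nat) \<Rightarrow> nat \<Rightarrow> (nat \<Rightarrow> nat) \<Rightarrow> nat \<Rightarrow> nat \<Rightarrow> nat \<Rightarrow> bool" where
  "expanding F rd q qn ex qh j l \<longleftrightarrow>
     (\<forall>e. ex e = rd \<longrightarrow> e < m \<and> ed e \<subseteq> q ` {..<qn}) \<and>
     (l = 0 \<or> qh < qn \<and> j < dg (q qh) \<and> ex (inc (q qh) j) \<noteq> rd \<and>
        (F (inc (q qh) j) = None \<or> (\<exists>u. F (inc (q qh) j) = Some (u, q qh))) \<and>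
        l \<le> length (el (inc (q qh) j)) \<and> set (take l (el (inc (q qh) j))) \<subseteq> q ` {..<qn})"

abbreviation "cnt ys \<equiv> length (filter (\<lambda>x. x \<in> S) ys)"

text \<open>Bounds how often vertices of \<open>S\<close> have been logged.\<close>

definition work :: "nat \<Rightarrow> (nat \<Rightarrow> nat) \<Rightarrow> (nat \<Rightarrow> nat) \<Rightarrow> nat \<Rightarrow> nat \<Rightarrow> nat \<Rightarrow> nat" where
  "work rd q ex qh j l = (\<Sum>i<qh. if q i \<in> S then dg (q i) else 0) + (if q qh \<in> S then j else 0) +
     (\<Sum>e<m. if ex e = rd then cnt (el e) else 0) + cnt (take l (el (inc (q qh) j)))"

text \<open>The last conjunct holds because a logging step enqueues at most one vertex. It bounds
  the queue, and with it tree paths and outputs, by the length of the log.\<close>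

definition bfs where
  "bfs F rd q qn pv pe ex qh j l len lg \<longleftrightarrow> search_tree F q qn pv pe \<and> A \<subseteq> q ` {..<qn} \<and>
     explored F q qn qh j \<and> expanding F rd q qn ex qh j l \<and>
     (\<forall>i<len. lg i \<in> q ` {..<qn}) \<and> card {i. i < len \<and> lg i \<in> S} \<le> work rd q ex qh j l \<and>
     qn \<le> length xs + len"

lemma scanned_mono: "scanned F V v e \<Longrightarrow> V \<subseteq> V' \<Longrightarrow> scanned F V' v e"
  by (auto simp: scanned_def)

lemma bfs_vertex: "bfs F rd q qn pv pe ex qh j l len lg \<Longrightarrow> i < qn \<Longrightarrow> q i < n"
  by (auto simp: bfs_def search_tree_def)

lemma bfs_next_vertex:
  assumes "bfs F rd q qn pv pe ex qh j l len lg" "qh < qn" "\<not> j < dg (q qh)"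
  shows "bfs F rd q qn pv pe ex (Suc qh) 0 l len lg"
proof -
  have l: "l = 0" and j: "j = dg (q qh)"
    using assms by (auto simp: bfs_def expanding_def explored_def)
  have "explored F q qn (Suc qh) 0"
    using assms j by (auto simp: bfs_def explored_def less_Suc_eq)
  moreover have "work rd q ex (Suc qh) 0 l = work rd q ex qh j l"
    by (simp add: work_def l j)
  ultimately show ?thesis
    using assms l by (auto simp: bfs_def expanding_def)
qed

lemma search_tree_inj:
  "search_tree F q qn pv pe \<Longrightarrow> i < qn \<Longrightarrow> k < qn \<Longrightarrow> q i = q k \<longleftrightarrow> i = k"
  by (auto simp: search_tree_def inj_on_def)

text \<open>Only the condition on repeated hyperedges is delicate. If \<open>e\<close> already led
  from \<open>q i0\<close> to \<open>q i'\<close>, then \<open>q i0\<close> is completely scanned,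
  yet \<open>x\<close> was not found from there. So \<open>e\<close> carries a unit that enters at
  \<open>q i'\<close> and whose exit is not \<open>q i0\<close>; the step to \<open>x\<close> is
  possible only if that exit is \<open>q qh\<close>.\<close>

lemma search_tree_visit:
  assumes t: "search_tree F q qn pv pe" and qh: "qh < qn" and x: "x \<notin> q ` {..<qn}"
    and e: "tedge F (q qh) e x"
    and sc: "\<And>i e. i < qh \<Longrightarrow> e < m \<Longrightarrow> q i \<in> ed e \<Longrightarrow> scanned F (q ` {..<qn}) (q i) e"
  shows "search_tree F (q(qn := x)) (Suc qn) (pv(x := q qh)) (pe(x := e))"
proof -
  let ?q = "q(qn := x)" and ?pv = "pv(x := q qh)" and ?pe = "pe(x := e)"
  have img: "?q ` {..<Suc qn} = insert x (q ` {..<qn})"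
    by (auto simp: lessThan_Suc)
  have qx: "q i \<noteq> x" if "i < qn" for i using x that by auto
  have inj: "inj_on ?q {..<Suc qn}"
    using t x by (auto simp: search_tree_def inj_on_def less_Suc_eq)
  have xn: "x < n" using e ed_subset by (auto simp: tedge_def)
  have par: "?q i \<in> A \<and> ?pv (?q i) = ?q i \<or>
      (\<exists>i'<i. ?pv (?q i) = ?q i' \<and> tedge F (?q i') (?pe (?q i)) (?q i))" if i: "i < Suc qn" for i
  proof (cases "i = qn")
    case True
    with e qh show ?thesis by auto
  next
    case False
    with i have i: "i < qn" by simp
    then have "q i \<in> A \<and> pv (q i) = q i \<or>
      (\<exists>i'<i. pv (q i) = q i' \<and> tedge F (q i') (pe (q i)) (q i))"
      using t by (auto simp: search_tree_def)
    then show ?thesis using i qx[OF i] by fastforce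
  qed
  have twice: "F (?pe (?q i)) = Some (?q i', ?q i'')"
    if h: "i < Suc qn" "i'' < i" "i' \<le> i''" "?pv (?q i) = ?q i''" "?pv (?q i') \<noteq> ?q i'"
      "?pe (?q i) = ?pe (?q i')" for i i' i''
  proof (cases "i = qn")
    case False
    with h have i: "i < qn" "i' < qn" "i'' < qn" by auto
    then have "F (pe (q i)) = Some (q i', q i'')"
      using t h(2-) qx[OF i(1)] qx[OF i(2)] qx[OF i(3)] by (simp add: search_tree_def)
    then show ?thesis using i qx[OF i(1)] by simp
  next
    case True
    with h have i: "i' < qn" "i'' < qn" by auto
    have "i'' = qh" using h True i search_tree_inj[OF t i(2) qh] by auto
    then have i'qh: "i' \<le> qh" using h by simp
    have pe': "pe (q i') = e" and pv': "pv (q i') \<noteq> q i'"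
      using h True i qx[OF i(1)] by auto
    obtain i0 where i0: "i0 < i'" "tedge F (q i0) e (q i')"
      using t i(1) pv' pe' unfolding search_tree_def by blast
    have "scanned F (q ` {..<qn}) (q i0) e"
      using i0 i'qh by (intro sc) (auto simp: tedge_def)
    then have "\<not> trav F (q i0) e x"
      using x e by (auto simp: scanned_def tedge_def)
    then have "F e = Some (q i', q qh)"
      using i0 e by (auto simp: tedge_def trav_def split: option.splits)
    then show ?thesis using True i \<open>i'' = qh\<close> by auto
  qed
  show ?thesis
    unfolding search_tree_def
    using inj img xn t par twice by (auto simp: search_tree_def)
qed

text \<open>One step of the search looks at the hyperedge \<open>e\<close> from its vertex \<open>v\<close>: it proposes \<open>x\<close> as a
  new vertex and logs \<open>y\<close>.\<close>

definition scan_step where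
  "scan_step F rd v e ex j l x y ex' j' l' \<longleftrightarrow>
    (if \<exists>u w. F e = Some (u, w) \<and> w \<noteq> v
     then x = fst (the (F e)) \<and> y = v \<and> ex' = ex \<and> j' = Suc j \<and> l' = l
     else if ex e = rd then x = v \<and> y = v \<and> ex' = ex \<and> j' = Suc j \<and> l' = l
     else if l < length (el e) then x = lookup (el e) l \<and> y = x \<and> ex' = ex \<and> j' = j \<and> l' = Suc l
     else x = v \<and> y = v \<and> ex' = ex(e := rd) \<and> j' = Suc j \<and> l' = 0)"

definition visit_step where
  "visit_step v e x q qn pv pe q' qn' pv' pe' \<longleftrightarrow>
    (if x \<in> q ` {..<qn} then q' = q \<and> qn' = qn \<and> pv' = pv \<and> pe' = pe
     else q' = q(qn := x) \<and> qn' = Suc qn \<and> pv' = pv(x := v) \<and> pe' = pe(x := e))"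

lemma card_log:
  "card {i. i < Suc len \<and> (lg(len := y)) i \<in> S} = card {i. i < len \<and> lg i \<in> S} + of_bool (y \<in> S)"
proof -
  have "{i. i < Suc len \<and> (lg(len := y)) i \<in> S} =
    {i. i < len \<and> lg i \<in> S} \<union> (if y \<in> S then {len} else {})"
    by (auto simp: less_Suc_eq)
  then show ?thesis by (auto simp: card_insert_if)
qed

lemma bfs_scan:
  assumes b: "bfs F rd q qn pv pe ex qh j l len lg" and F: "valid_flow F"
    and qh: "qh < qn" and j: "j < dg (q qh)"
    and st: "scan_step F rd (q qh) (inc (q qh) j) ex j l x y ex' j' l'"
    and vs: "visit_step (q qh) (inc (q qh) j) x q qn pv pe q' qn' pv' pe'"
  shows "bfs F rd q' qn' pv' pe' ex' qh j' l' (Suc len) (lg(len := y)) \<and> x \<in> q' ` {..<qn'} \<and>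
    q' ` {..<qn'} = insert x (q ` {..<qn})"
proof -
  define v where "v = q qh"
  define e where "e = inc v j"
  note st = st[folded v_def, folded e_def] and vs = vs[folded v_def, folded e_def]
  let ?V = "q ` {..<qn}" and ?V' = "q' ` {..<qn'}"
  have tr: "search_tree F q qn pv pe" and AV: "A \<subseteq> ?V" and expl: "explored F q qn qh j"
    and expa: "expanding F rd q qn ex qh j l" and lgV: "\<forall>i<len. lg i \<in> ?V"
    and lgS: "card {i. i < len \<and> lg i \<in> S} \<le> work rd q ex qh j l" and qn: "qn \<le> length xs + len"
    using b by (auto simp: bfs_def)
  have vV: "v \<in> ?V" using qh by (auto simp: v_def)
  have vn: "v < n" using bfs_vertex[OF b qh] by (simp add: v_def)
  have e: "e < m" "v \<in> ed e" using inc_edge[OF vn] j by (auto simp: e_def v_def)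
  have sc: "scanned F ?V (q i) e'" if "i < qh" "e' < m" "q i \<in> ed e'" for i e'
    using edge_inc[OF that(2,3)] expl that(1) by (metis explored_def)
  \<comment> \<open>Branches that find nothing propose \<open>v\<close> itself, which is already
    queued. So a new \<open>x\<close> is either the entry of the unit on \<open>e\<close> or a
    vertex read during an expansion.\<close>
  have te: "tedge F v e x" if "x \<notin> ?V"
  proof -
    have xe: "x \<in> ed e"
      using st that vV e F
      by (auto simp: scan_step_def valid_flow_def lookup_def split: if_splits)
    moreover have "trav F v e x"
      using st that vV by (auto simp: scan_step_def trav_def split: if_splits option.splits)
    ultimately show ?thesis using e by (simp add: tedge_def)
  qed
  have tr': "search_tree F q' qn' pv' pe'"
  proof (cases "x \<in> ?V")
    case True
    then show ?thesis using vs tr by (simp add: visit_step_def)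
  next
    case False
    have "search_tree F (q(qn := x)) (Suc qn) (pv(x := v)) (pe(x := e))"
      using search_tree_visit[OF tr qh False te[OF False, unfolded v_def] sc] by (simp add: v_def)
    then show ?thesis using vs False by (simp add: visit_step_def)
  qed
  have V': "?V' = insert x ?V"
    using vs by (auto simp: visit_step_def lessThan_Suc split: if_splits)
  then have VV': "?V \<subseteq> ?V'" by auto
  have qq: "q' i = q i" if "i < qn" for i
    using vs that by (auto simp: visit_step_def split: if_splits)
  have q'v: "q' qh = v" using qq[OF qh] by (simp add: v_def)
  have qnq: "qn \<le> qn'" "qn' \<le> Suc qn"
    using vs by (auto simp: visit_step_def split: if_splits)
  have yV: "y \<in> ?V'"
    using st vV V' by (auto simp: scan_step_def split: if_splits)
  have expl1: "scanned F ?V' (q' i) (inc (q' i) j0)" if "i < qh" "j0 < dg (q' i)" for i j0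
    using expl that scanned_mono[OF _ VV'] qq[of i] qh by (auto simp: explored_def)
  have expl2: "scanned F ?V' v (inc v j0)" if "j0 < j" for j0
    using expl that scanned_mono[OF _ VV'] qh by (auto simp: explored_def v_def)
  have ex1: "ex e0 = rd \<longrightarrow> e0 < m \<and> ed e0 \<subseteq> ?V'" for e0
    using expa VV' unfolding expanding_def by blast
  have lpart: "l = 0 \<or> ex e \<noteq> rd \<and> (F e = None \<or> (\<exists>u. F e = Some (u, v))) \<and>
      l \<le> length (el e) \<and> set (take l (el e)) \<subseteq> ?V"
    using expa by (auto simp: expanding_def v_def e_def)
  have sums: "(\<Sum>i<qh. if q' i \<in> S then dg (q' i) else 0) = (\<Sum>i<qh. if q i \<in> S then dg (q i) else 0)"
    using qq qh by (intro sum.cong) auto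
  have work': "work rd q' ex0 qh j0 l0 = (\<Sum>i<qh. if q i \<in> S then dg (q i) else 0) +
     (if v \<in> S then j0 else 0) + (\<Sum>e<m. if ex0 e = rd then cnt (el e) else 0) +
     cnt (take l0 (el (inc v j0)))" for ex0 j0 l0
    unfolding work_def sums q'v ..
  have work: "work rd q ex qh j l = (\<Sum>i<qh. if q i \<in> S then dg (q i) else 0) +
     (if v \<in> S then j else 0) + (\<Sum>e<m. if ex e = rd then cnt (el e) else 0) +
     cnt (take l (el e))"
    unfolding work_def by (simp add: v_def e_def)
  let ?G = "explored F q' qn' qh j' \<and> expanding F rd q' qn' ex' qh j' l' \<and>
     work rd q ex qh j l + of_bool (y \<in> S) \<le> work rd q' ex' qh j' l'"
  \<comment> \<open>Three of the four branches leave the incidence and log \<open>v\<close>, which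
    is charged to the increment of \<open>j\<close>. They differ only in whether \<open>e\<close>
    becomes marked as expanded.\<close>
  have advance: ?G if sce: "scanned F ?V' v e" and h: "j' = Suc j" "l' = 0" "y = v"
    and ex': "ex' = ex \<and> l = 0 \<or> ex' = ex(e := rd) \<and> ex e \<noteq> rd \<and> ed e \<subseteq> ?V' \<and> l \<ge> length (el e)"
  proof (intro conjI)
    show "explored F q' qn' qh j'"
      unfolding explored_def using qh qnq expl1 expl2 sce j h(1)
      by (auto simp: q'v less_Suc_eq e_def[symmetric] v_def[symmetric])
    show "expanding F rd q' qn' ex' qh j' l'"
    proof -
      have "e0 < m \<and> ed e0 \<subseteq> ?V'" if "ex' e0 = rd" for e0
      proof -
        have "e0 = e \<and> ed e \<subseteq> ?V' \<or> ex e0 = rd" using ex' that by (metis fun_upd_apply)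
        then show ?thesis using ex1[of e0] e(1) by auto
      qed
      then show ?thesis by (simp add: expanding_def h)
    qed
    from ex' show "work rd q ex qh j l + of_bool (y \<in> S) \<le> work rd q' ex' qh j' l'"
    proof
      assume "ex' = ex \<and> l = 0"
      then show ?thesis unfolding work work' h by simp
    next
      assume a: "ex' = ex(e := rd) \<and> ex e \<noteq> rd \<and> ed e \<subseteq> ?V' \<and> l \<ge> length (el e)"
      \<comment> \<open>The charge of the prefix of length \<open>l\<close>, by now all of
        \<open>e\<close>, moves to the sum over expanded hyperedges.\<close>
      have "(\<Sum>e'<m. if ex' e' = rd then cnt (el e') else 0) =
        (\<Sum>e'<m. (if ex e' = rd then cnt (el e') else 0) + (if e' = e then cnt (el e) else 0))"
        using a by (intro sum.cong) auto
      also have "\<dots> = (\<Sum>e'<m. if ex e' = rd then cnt (el e') else 0) + cnt (el e)"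
        using e(1) by (simp add: sum.distrib)
      finally show ?thesis using a unfolding work work' h by simp
    qed
  qed
  have ?G
  proof (cases "\<exists>u w. F e = Some (u, w) \<and> w \<noteq> v")
    case True
    then obtain u w where uw: "F e = Some (u, w)" "w \<noteq> v" by blast
    then have h: "x = u" "y = v" "ex' = ex" "j' = Suc j" "l' = l"
      using st by (auto simp: scan_step_def)
    have l: "l = 0" using lpart uw by auto
    have "scanned F ?V' v e" using V' h uw by (auto simp: scanned_def trav_def)
    then show ?thesis using h l by (intro advance) auto
  next
    case nT: False
    show ?thesis
    proof (cases "ex e = rd")
      case True
      then have h: "x = v" "y = v" "ex' = ex" "j' = Suc j" "l' = l"
        using st nT by (auto simp: scan_step_def)
      have l: "l = 0" using lpart True by auto
      have "scanned F ?V' v e" using ex1 True by (auto simp: scanned_def)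
      then show ?thesis using h l by (intro advance) auto
    next
      case nE: False
      show ?thesis
      proof (cases "l < length (el e)")
        case True
        then have h: "x = el e ! l" "y = x" "ex' = ex" "j' = j" "l' = Suc l"
          using st nT nE by (auto simp: scan_step_def lookup_def)
        have "explored F q' qn' qh j'"
          unfolding explored_def using qh qnq expl1 expl2 j h(4)
          by (auto simp: q'v v_def[symmetric])
        moreover have "set (take (Suc l) (el e)) \<subseteq> ?V'"
          using lpart True V' h(1) by (auto simp: take_Suc_conv_app_nth)
        then have "expanding F rd q' qn' ex' qh j' l'"
          unfolding expanding_def using ex1 nE nT h qh qnq(1) j True
          by (cases "F e") (auto simp: q'v e_def[symmetric] v_def[symmetric])
        \<comment> \<open>The vertex logged here is the one just read, so it is charged to its
          position in \<open>e\<close> instead of to an incidence of \<open>v\<close>.\<close>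
        moreover have "cnt (take (Suc l) (el e)) = cnt (take l (el e)) + of_bool (x \<in> S)"
          using True h by (simp add: take_Suc_conv_app_nth)
        then have "work rd q ex qh j l + of_bool (y \<in> S) \<le> work rd q' ex' qh j' l'"
          by (simp add: work work' h e_def[symmetric])
        ultimately show ?thesis by simp
      next
        case False
        then have h: "x = v" "y = v" "ex' = ex(e := rd)" "j' = Suc j" "l' = 0"
          using st nT nE by (auto simp: scan_step_def)
        have "ed e \<subseteq> ?V'" using lpart False VV' by auto
        then show ?thesis using h nE False by (intro advance) (auto simp: scanned_def)
      qed
    qed
  qed
  moreover have "\<forall>i<Suc len. (lg(len := y)) i \<in> ?V'"
    using lgV yV VV' by (auto simp: less_Suc_eq)
  moreover have "qn' \<le> length xs + Suc len" using qn qnq by simp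
  ultimately show ?thesis
    using lgS V' AV VV' tr' unfolding bfs_def card_log by auto
qed

lemma bfs_closed:
  assumes b: "bfs F rd q qn pv pe ex qn j l len lg"
  shows "closed_set F (q ` {..<qn})"
  unfolding closed_set_def
proof (intro ballI allI impI)
  fix v e x assume "v \<in> q ` {..<qn}" and t: "tedge F v e x"
  then obtain i where i: "i < qn" "v = q i" by auto
  obtain j where "j < dg v" "inc v j = e" using t edge_inc by (metis tedge_def)
  then have "scanned F (q ` {..<qn}) v e" using b i by (auto simp: bfs_def explored_def)
  then show "x \<in> q ` {..<qn}" using t by (auto simp: scanned_def tedge_def)
qed

text \<open>Tree edges are residual steps, so a tree rooted in \<open>A\<close> cannot leave a
  closed set. With \<open>X = S\<close> this supplies the inclusion that \<open>closed_ge\<close>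
  leaves open.\<close>

lemma search_tree_reach:
  assumes t: "search_tree F q qn pv pe" and X: "A \<subseteq> X" "closed_set F X"
  shows "q ` {..<qn} \<subseteq> X"
proof -
  have "i < qn \<Longrightarrow> q i \<in> X" for i
  proof (induction i rule: less_induct)
    case (less i)
    then consider "q i \<in> A" | i' where "i' < i" "tedge F (q i') (pe (q i)) (q i)"
      using t by (auto simp: search_tree_def)
    then show ?case
    proof cases
      case 2
      then show ?thesis using less X unfolding closed_set_def by force
    qed (use X in auto)
  qed
  then show ?thesis by auto
qed

text \<open>Each half of \<open>work\<close> counts an incidence of \<open>S\<close> at most once:
  the first because queue entries are distinct, the second because a hyperedge is expanded at most
  once.\<close>

lemma log_bound:
  assumes b: "bfs F rd q qn pv pe ex qh j l len lg" and qh: "qh < qn"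
  shows "card {i. i < len \<and> lg i \<in> S} \<le> 2 * \<nu>"
proof -
  have tr: "search_tree F q qn pv pe" and expl: "explored F q qn qh j"
    and expa: "expanding F rd q qn ex qh j l" using b by (auto simp: bfs_def)
  have jd: "j \<le> dg (q qh)" using expl qh by (simp add: explored_def)
  have "(\<Sum>i<qh. if q i \<in> S then dg (q i) else 0) + (if q qh \<in> S then j else 0) \<le>
      (\<Sum>i<Suc qh. if q i \<in> S then dg (q i) else 0)"
    using jd by simp
  also have "\<dots> \<le> (\<Sum>i<qn. if q i \<in> S then dg (q i) else 0)"
    using qh by (intro sum_mono2) auto
  also have "\<dots> = (\<Sum>v\<in>q ` {..<qn}. if v \<in> S then dg v else 0)"
    using tr by (subst sum.reindex) (auto simp: search_tree_def)
  also have "\<dots> = (\<Sum>v\<in>q ` {..<qn} \<inter> S. dg v)"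
    by (simp add: sum.inter_restrict)
  also have "\<dots> \<le> (\<Sum>v\<in>S. dg v)"
    using S_props by (intro sum_mono2) auto
  also have "\<dots> = vol G S"
    unfolding vol_def using S_props by (intro sum.cong) (auto simp: dg_eq_deg)
  finally have 1: "(\<Sum>i<qh. if q i \<in> S then dg (q i) else 0) + (if q qh \<in> S then j else 0) \<le> vol G S" .
  have 2: "(\<Sum>e<m. if ex e = rd then cnt (el e) else 0) + cnt (take l (el (inc (q qh) j))) \<le> vol G S"
  proof (cases "l = 0")
    case True
    then show ?thesis unfolding vol_eq[OF S_props(4)] by (auto intro: sum_mono)
  next
    case False
    define e where "e = inc (q qh) j"
    have e: "ex e \<noteq> rd" "e < m"
      using expa False inc_edge(1)[OF bfs_vertex[OF b qh]] by (auto simp: expanding_def e_def)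
    \<comment> \<open>The prefix of an unfinished expansion is not charged twice, since its
      hyperedge is not yet marked.\<close>
    have "cnt (take l (el e)) \<le> cnt (take l (el e)) + cnt (drop l (el e))" by simp
    also have "\<dots> = cnt (el e)" by (metis append_take_drop_id filter_append length_append)
    finally have "(\<Sum>e<m. if ex e = rd then cnt (el e) else 0) + cnt (take l (el e)) \<le>
       (\<Sum>e<m. if ex e = rd then cnt (el e) else 0) + (\<Sum>e'<m. if e' = e then cnt (el e) else 0)"
      using e by simp
    also have "\<dots> = (\<Sum>e'<m. (if ex e' = rd then cnt (el e') else 0) + (if e' = e then cnt (el e) else 0))"
      by (rule sum.distrib[symmetric])
    also have "\<dots> \<le> vol G S"
      unfolding vol_eq[OF S_props(4)] using e by (intro sum_mono) auto
    finally show ?thesis by (simp add: e_def)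
  qed
  have "card {i. i < len \<and> lg i \<in> S} \<le> work rd q ex qh j l" using b by (simp add: bfs_def)
  also have "\<dots> \<le> 2 * vol G S" using 1 2 by (simp add: work_def)
  finally show ?thesis using vol by simp
qed

lemma bfs_init:
  assumes q: "\<And>i. i < length xs \<Longrightarrow> q i = xs ! i" and pv: "\<And>x. x \<in> A \<Longrightarrow> pv x = x"
    and ex: "\<And>e. ex e < rd"
  shows "bfs F rd q (length xs) pv pe ex 0 0 0 0 lg"
proof -
  have img: "q ` {..<length xs} = A" using q xs by (force simp: in_set_conv_nth)
  have inj: "inj_on q {..<length xs}"
    using q xs by (auto simp: inj_on_def nth_eq_iff_index_eq)
  have root: "q i \<in> A \<and> pv (q i) = q i" if "i < length xs" for i
    using img pv that by auto
  have "search_tree F q (length xs) pv pe"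
    unfolding search_tree_def using inj root img AG by (auto simp: verts_eq)
  then show ?thesis
    using img ex by (auto simp: bfs_def explored_def expanding_def dest: less_imp_neq)
qed

text \<open>Invariant of the augmentation along the tree path from \<open>t\<close> back to its root, at \<open>q i\<close>: the
  remaining tree edges are unaffected, except that the head of a hyperedge may have been
  redirected.\<close>

definition augmenting where
  "augmenting F0 q qn pv pe t F i \<longleftrightarrow> i < qn \<and> valid_flow F \<and>
     (\<forall>X. net X F = net X F0 + of_bool (q i \<in> X) - of_bool (t \<in> X)) \<and>
     (\<forall>i'\<le>i. pv (q i') \<noteq> q i' \<longrightarrow>
        F (pe (q i')) = F0 (pe (q i')) \<or> (\<exists>w. F (pe (q i')) = Some (q i', w)))"

lemma augmenting_init:
  assumes "flow_ends F0 ts" "i < qn"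
  shows "augmenting F0 q qn pv pe (q i) F0 i"
  using assms by (auto simp: augmenting_def flow_ends_def)

text \<open>The step into \<open>q i\<close> survives earlier pushes: the entry of a changed
  hyperedge is \<open>q i\<close>, and moving towards the entry is always allowed. If a step still
  to come uses the same hyperedge, the tree condition says that the unit exits at the parent
  \<open>q i'\<close>; the push then redirects this exit and leaves the entry \<open>q k\<close>
  alone.\<close>

lemma augmenting_step:
  assumes tr: "search_tree F0 q qn pv pe" and a: "augmenting F0 q qn pv pe t F i"
    and nr: "pv (q i) \<noteq> q i"
  shows "\<exists>i'<i. pv (q i) = q i' \<and>
    augmenting F0 q qn pv pe t (push F (pv (q i)) (pe (q i)) (q i)) i'"
proof -
  let ?e = "pe (q i)"
  have i: "i < qn" using a by (simp add: augmenting_def)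
  obtain i' where i': "i' < i" "pv (q i) = q i'" and te0: "tedge F0 (q i') ?e (q i)"
    using tr i nr by (auto simp: search_tree_def)
  have st: "F ?e = F0 ?e \<or> (\<exists>w. F ?e = Some (q i, w))"
    using a nr by (auto simp: augmenting_def)
  have te: "tedge F (q i') ?e (q i)"
    using te0 st by (auto simp: tedge_def trav_def)
  have "push F (q i') ?e (q i) (pe (q k)) = F0 (pe (q k)) \<or>
      (\<exists>w. push F (q i') ?e (q i) (pe (q k)) = Some (q k, w))"
    if k: "k \<le> i'" and nrk: "pv (q k) \<noteq> q k" for k
  proof (cases "pe (q k) = ?e")
    case False
    then show ?thesis using a k nrk i' by (auto simp: augmenting_def push_def)
  next
    case True
    have F0: "F0 ?e = Some (q k, q i')"
      using tr i i' k nrk True unfolding search_tree_def by metis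
    have "F (pe (q k)) = F0 (pe (q k)) \<or> (\<exists>w. F (pe (q k)) = Some (q k, w))"
      using a k nrk i' by (simp add: augmenting_def)
    then have "F ?e = F0 ?e \<or> (\<exists>w. F ?e = Some (q k, w))"
      unfolding True .
    moreover have "q k \<noteq> q i"
      using search_tree_inj[OF tr, of k i] i i' k by auto
    \<comment> \<open>Had the hyperedge been changed before, its entry would be both
      \<open>q i\<close> and \<open>q k\<close>.\<close>
    ultimately have "F ?e = Some (q k, q i')" using st F0 by auto
    then show ?thesis using True by (auto simp: push_def)
  qed
  then have "augmenting F0 q qn pv pe t (push F (q i') ?e (q i)) i'"
    using a i i' te by (auto simp: augmenting_def net_push valid_push)
  with i' show ?thesis by auto
qed

text \<open>The root lies in \<open>A\<close> and hence in every \<open>X\<close> considered, so the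
  telescoped change is 1 if \<open>t\<close> is outside \<open>X\<close> and 0 otherwise.\<close>

lemma augmenting_done:
  assumes tr: "search_tree F0 q qn pv pe" and f: "flow_ends F0 ts"
    and a: "augmenting F0 q qn pv pe t F i" and r: "pv (q i) = q i"
  shows "flow_ends F (t # ts)"
proof -
  have i: "i < qn" using a by (simp add: augmenting_def)
  have "q i \<in> A"
  proof (rule ccontr)
    assume "q i \<notin> A"
    then obtain i' where "i' < i" "pv (q i) = q i'" using tr i by (auto simp: search_tree_def)
    then show False using r search_tree_inj[OF tr, of i i'] i by auto
  qed
  then show ?thesis using a f by (auto simp: augmenting_def flow_ends_def)
qed

end


section \<open>The program\<close>

text \<open>No array is ever cleared: \<open>fs[e] = run\<close> marks the hyperedges carrying flow in the current run,
  \<open>vis[x] = rd\<close> the vertices reached and \<open>ex[e] = rd\<close> the hyperedges expanded in the current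
  search.  The array \<open>log\<close> records one endpoint per step of the search.\<close>

abbreviation "var x \<equiv> Get x (Const 0)"
abbreviation "assign x a \<equiv> Assign x (Const 0) a"
abbreviation "incr x \<equiv> Assign x (Const 0) (Plus (Get x (Const 0)) (Const 1))"

definition init_roots :: com where
  "init_roots = While (Less (var ''qn'') (var ''lenA''))
     (Seq (Assign ''vis'' (Get ''A'' (var ''qn'')) (var ''rd''))
     (Seq (Assign ''pv'' (Get ''A'' (var ''qn'')) (Get ''A'' (var ''qn'')))
     (Seq (Assign ''q'' (var ''qn'') (Get ''A'' (var ''qn'')))
          (incr ''qn''))))"

text \<open>Presetting \<open>x\<close> and \<open>y\<close> to \<open>v\<close> provides the
  default of \<open>advance\<close>: a branch that finds nothing proposes \<open>v\<close>, which
  \<open>visit\<close> ignores.\<close>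

definition load_incidence :: com where
  "load_incidence =
     Seq (assign ''v'' (Get ''q'' (var ''qh'')))
     (Seq (assign ''e'' (IncEdge (var ''v'') (var ''j'')))
     (Seq (assign ''x'' (var ''v''))
          (assign ''y'' (var ''v''))))"

definition advance :: com where
  "advance =
     IfElse (Conj (Equal (Get ''fs'' (var ''e'')) (var ''run''))
                  (Neg (Equal (Get ''hd'' (var ''e'')) (var ''v''))))
       (Seq (assign ''x'' (Get ''tl'' (var ''e''))) (incr ''j''))
     (IfElse (Equal (Get ''ex'' (var ''e'')) (var ''rd''))
       (incr ''j'')
     (IfElse (Less (var ''l'') (EdgeSize (var ''e'')))
       (Seq (assign ''x'' (EdgeVert (var ''e'') (var ''l'')))
       (Seq (assign ''y'' (var ''x''))
            (incr ''l'')))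
       (Seq (Assign ''ex'' (var ''e'') (var ''rd''))
       (Seq (incr ''j'')
            (assign ''l'' (Const 0))))))"

definition visit :: com where
  "visit = IfElse (Equal (Get ''vis'' (var ''x'')) (var ''rd'')) Skip
     (Seq (Assign ''vis'' (var ''x'') (var ''rd''))
     (Seq (Assign ''pv'' (var ''x'') (var ''v''))
     (Seq (Assign ''pe'' (var ''x'') (var ''e''))
     (Seq (Assign ''q'' (var ''qn'') (var ''x''))
     (Seq (incr ''qn'')
          (assign ''st'' (InB (var ''x''))))))))"

definition scan :: com where
  "scan = IfElse (Less (var ''j'') (Degree (Get ''q'' (var ''qh''))))
     (Seq (Seq load_incidence advance)
     (Seq (Assign ''log'' (var ''len'') (var ''y''))
     (Seq (incr ''len'')
          visit)))
     (Seq (incr ''qh'') (assign ''j'' (Const 0)))"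

definition search :: com where
  "search =
     Seq (incr ''rd'')
     (Seq (assign ''qn'' (Const 0))
     (Seq init_roots
     (Seq (Seq (assign ''qh'' (Const 0))
          (Seq (assign ''j'' (Const 0))
          (Seq (assign ''l'' (Const 0))
          (Seq (assign ''len'' (Const 0))
               (assign ''st'' (Const 0))))))
     (While (Conj (Less (var ''qh'') (var ''qn''))
            (Conj (Equal (var ''st'') (Const 0)) (Less (var ''len'') (var ''M''))))
        scan))))"

definition augment :: com where
  "augment = While (Neg (Equal (Get ''pv'' (var ''x'')) (var ''x'')))
     (Seq (assign ''v'' (Get ''pv'' (var ''x'')))
     (Seq (assign ''e'' (Get ''pe'' (var ''x'')))
     (Seq (IfElse (Equal (Get ''fs'' (var ''e'')) (var ''run''))
            (IfElse (Equal (Get ''hd'' (var ''e'')) (var ''v''))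
              (Assign ''hd'' (var ''e'') (var ''x''))
              (Assign ''tl'' (var ''e'') (var ''v'')))
            (Seq (Assign ''fs'' (var ''e'') (var ''run''))
            (Seq (Assign ''tl'' (var ''e'') (var ''v''))
                 (Assign ''hd'' (var ''e'') (var ''x'')))))
          (assign ''x'' (var ''v'')))))"

text \<open>Setting \<open>best\<close> to \<open>f\<close> also ends the current run, which
  continues only while \<open>f < best\<close>.\<close>

definition emit :: com where
  "emit =
     Seq (assign ''best'' (var ''f''))
     (Seq (assign ''lenout'' (Const 0))
     (While (Less (var ''lenout'') (var ''qn''))
       (Seq (Assign ''out'' (var ''lenout'') (Get ''q'' (var ''lenout'')))
            (incr ''lenout''))))"

text \<open>If \<open>st\<close> is nonzero, \<open>x\<close> still holds the vertex of
  \<open>B\<close> just visited. Otherwise the log is full, and a tree path to the drawn entry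
  exists because only queued vertices are logged.\<close>

definition flow_round :: com where
  "flow_round = Seq search
     (IfElse (Conj (Equal (var ''st'') (Const 0)) (Neg (Less (var ''qh'') (var ''qn''))))
       emit
       (Seq (IfElse (Equal (var ''st'') (Const 0))
              (Seq (Sample ''r'' (Const 0) (var ''M''))
                   (assign ''x'' (Get ''log'' (var ''r''))))
              Skip)
            (Seq augment (incr ''f''))))"

text \<open>The machine cannot multiply, so \<open>M\<close> is accumulated by \<open>c + 1\<close>
  additions of \<open>4 \<nu> + 4\<close>. The initial \<open>best = c + 1\<close> exceeds every
  admissible cut value and caps the rounds of a run. Doubling \<open>pow\<close> up to the number of
  vertices gives the logarithmic number of runs.\<close>

definition LocalMinCut :: com where
  "LocalMinCut =
     Seq (assign ''k'' (Plus (var ''c'') (Const 1)))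
     (Seq (assign ''best'' (var ''k''))
     (Seq (assign ''pow'' (Const 1))
     (Seq (While (Less (var ''i'') (var ''k''))
            (Seq (incr ''i'')
                 (assign ''M'' (Plus (Plus (var ''M'') (Plus (var ''nu'') (var ''nu'')))
                    (Plus (Plus (var ''nu'') (var ''nu'')) (Const 4))))))
     (While (Less (var ''pow'') NumVerts)
       (Seq (assign ''pow'' (Plus (var ''pow'') (var ''pow'')))
       (Seq (incr ''run'')
       (Seq (assign ''f'' (Const 0))
       (While (Less (var ''f'') (var ''best'')) flow_round))))))))"


section \<open>Correctness of the search and of the augmentation\<close>

definition flow_of :: "store \<Rightarrow> flow" where
  "flow_of s = (\<lambda>e. if s ''fs'' e = s ''run'' 0 then Some (s ''tl'' e, s ''hd'' e) else None)"

lemma store_upd_apply: "store_upd s x i k y = (if y = x then (s y)(i := k) else s y)"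
  by (simp add: store_upd_def)

context local_cut
begin

abbreviation "K \<equiv> Suc c"
abbreviation "M \<equiv> 4 * K * Suc \<nu>"
abbreviation "ev\<^sub>0 \<equiv> ev R B"
abbreviation "runs\<^sub>0 \<equiv> runs R B S"

text \<open>The inequalities say that no stamp is ahead of its counter, so incrementing
  \<open>rd\<close> or \<open>run\<close> erases all marks at once.\<close>

definition env :: "store \<Rightarrow> bool" where
  "env s \<longleftrightarrow> s ''A'' = lookup xs \<and> s ''lenA'' 0 = length xs \<and> s ''k'' 0 = K \<and> s ''M'' 0 = M \<and>
     (\<forall>x. s ''vis'' x \<le> s ''rd'' 0) \<and> (\<forall>e. s ''ex'' e \<le> s ''rd'' 0) \<and> (\<forall>e. s ''fs'' e \<le> s ''run'' 0)"

text \<open>The part of the store that a search does not touch.\<close>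

definition outer where
  "outer s = (s ''best'' 0, s ''pow'' 0, s ''run'' 0, s ''f'' 0, (s ''fs'', s ''tl'', s ''hd''),
     s ''out'', s ''lenout'' 0)"

definition queue :: "store \<Rightarrow> nat set" where
  "queue s = s ''q'' ` {..<s ''qn'' 0}"

definition bfs_of :: "store \<Rightarrow> bool" where
  "bfs_of s \<longleftrightarrow> bfs (flow_of s) (s ''rd'' 0) (s ''q'') (s ''qn'' 0) (s ''pv'') (s ''pe'') (s ''ex'')
     (s ''qh'' 0) (s ''j'' 0) (s ''l'' 0) (s ''len'' 0) (s ''log'')"

definition searching :: "store \<Rightarrow> bool" where
  "searching s \<longleftrightarrow> env s \<and> bfs_of s \<and> s ''len'' 0 \<le> M \<and> (\<forall>x. s ''vis'' x = s ''rd'' 0 \<longleftrightarrow> x \<in> queue s) \<and>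
     (if s ''st'' 0 = 0 then queue s \<inter> B = {} else s ''x'' 0 \<in> B \<inter> queue s)"

lemma flow_of_cong:
  "s' ''fs'' = s ''fs'' \<Longrightarrow> s' ''tl'' = s ''tl'' \<Longrightarrow> s' ''hd'' = s ''hd'' \<Longrightarrow> s' ''run'' 0 = s ''run'' 0 \<Longrightarrow>
    flow_of s' = flow_of s"
  by (simp add: flow_of_def cong: if_cong)

lemma outer_flow: "outer s = outer s' \<Longrightarrow> flow_of s = flow_of s'"
  by (auto simp: outer_def flow_of_def)

lemma ev_load_incidence:
  assumes "s' = ev\<^sub>0 load_incidence s"
  shows "s' ''v'' 0 = s ''q'' (s ''qh'' 0)"
    "s' ''e'' 0 = inc (s ''q'' (s ''qh'' 0)) (s ''j'' 0)"
    "s' ''x'' 0 = s ''q'' (s ''qh'' 0)"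
    "s' ''y'' 0 = s ''q'' (s ''qh'' 0)"
    "y \<notin> {''v'', ''e'', ''x'', ''y''} \<Longrightarrow> s' y = s y"
  by (simp_all add: assms load_incidence_def store_upd_apply)

lemma ev_advance:
  assumes "s' = ev\<^sub>0 advance s" "s ''x'' 0 = s ''v'' 0" "s ''y'' 0 = s ''v'' 0"
  shows "scan_step (flow_of s) (s ''rd'' 0) (s ''v'' 0) (s ''e'' 0) (s ''ex'') (s ''j'' 0) (s ''l'' 0)
       (s' ''x'' 0) (s' ''y'' 0) (s' ''ex'') (s' ''j'' 0) (s' ''l'' 0)" (is ?step)
    and "y \<notin> {''x'', ''y'', ''ex'', ''j'', ''l''} \<Longrightarrow> s' y = s y" (is "?out \<Longrightarrow> ?frame")
proof -
  define v where "v = s ''v'' 0"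
  define e where "e = s ''e'' 0"
  let ?T = "s ''fs'' e = s ''run'' 0 \<and> s ''hd'' e \<noteq> v" and ?E = "s ''ex'' e = s ''rd'' 0"
    and ?L = "s ''l'' 0 < length (el e)"
  have T: "(\<exists>u w. flow_of s e = Some (u, w) \<and> w \<noteq> v) \<longleftrightarrow> ?T" and hd: "?T \<Longrightarrow> fst (the (flow_of s e)) = s ''tl'' e"
    by (auto simp: flow_of_def)
  note unf = scan_step_def v_def[symmetric] e_def[symmetric] T
  have st': "s' = ev\<^sub>0 advance s" by (rule assms(1))
  have xy: "s ''x'' 0 = v" "s ''y'' 0 = v" using assms(2,3) by (simp_all add: v_def)
  consider "?T" | "\<not> ?T" "?E" | "\<not> ?T" "\<not> ?E" "?L" | "\<not> ?T" "\<not> ?E" "\<not> ?L" by blast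
  then have "?step \<and> (?out \<longrightarrow> ?frame)"
  proof cases
    case 1
    have s': "s' = ev\<^sub>0 (Seq (assign ''x'' (Get ''tl'' (var ''e''))) (incr ''j'')) s"
      using 1 unfolding st' advance_def v_def e_def by (simp del: ev.simps(2,4))
    show ?thesis unfolding unf if_P[OF 1] hd[OF 1]
      by (simp add: s' store_upd_apply xy v_def[symmetric] e_def[symmetric])
  next
    case 2
    have s': "s' = ev\<^sub>0 (incr ''j'') s"
      using 2 unfolding st' advance_def v_def e_def by (auto simp del: ev.simps(2,4))
    show ?thesis unfolding unf if_not_P[OF 2(1)] if_P[OF 2(2)]
      by (simp add: s' store_upd_apply xy v_def[symmetric] e_def[symmetric])
  next
    case 3
    have s': "s' = ev\<^sub>0 (Seq (assign ''x'' (EdgeVert (var ''e'') (var ''l'')))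
        (Seq (assign ''y'' (var ''x'')) (incr ''l''))) s"
      using 3 unfolding st' advance_def v_def e_def by (auto simp del: ev.simps(2,4))
    show ?thesis unfolding unf if_not_P[OF 3(1)] if_not_P[OF 3(2)] if_P[OF 3(3)]
      by (simp add: s' store_upd_apply xy v_def[symmetric] e_def[symmetric])
  next
    case 4
    have s': "s' = ev\<^sub>0 (Seq (Assign ''ex'' (var ''e'') (var ''rd''))
        (Seq (incr ''j'') (assign ''l'' (Const 0)))) s"
      using 4 unfolding st' advance_def v_def e_def by (auto simp del: ev.simps(2,4))
    show ?thesis unfolding unf if_not_P[OF 4(1)] if_not_P[OF 4(2)] if_not_P[OF 4(3)]
      by (simp add: s' store_upd_apply xy v_def[symmetric] e_def[symmetric])
  qed
  then show ?step "?out \<Longrightarrow> ?frame" by blast+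
qed

lemma ev_visit:
  assumes "s' = ev\<^sub>0 visit s" "\<And>x. s ''vis'' x = s ''rd'' 0 \<longleftrightarrow> x \<in> queue s"
  shows "visit_step (s ''v'' 0) (s ''e'' 0) (s ''x'' 0) (s ''q'') (s ''qn'' 0) (s ''pv'') (s ''pe'')
      (s' ''q'') (s' ''qn'' 0) (s' ''pv'') (s' ''pe'')"
    "s' ''st'' 0 = (if s ''x'' 0 \<in> queue s then s ''st'' 0 else of_bool (s ''x'' 0 \<in> B))"
    "s' ''vis'' = (s ''vis'')(s ''x'' 0 := s ''rd'' 0)"
    "y \<notin> {''vis'', ''pv'', ''pe'', ''q'', ''qn'', ''st''} \<Longrightarrow> s' y = s y"
  using assms(2)[of "s ''x'' 0"]
  unfolding assms(1) visit_def visit_step_def queue_def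
  by (auto simp: store_upd_apply)

text \<open>The sum \<open>len + qh\<close> grows by one in every step; this is the progress measure
  of the search loop.\<close>

lemma runs_scan:
  assumes s: "searching s" and g: "s ''qh'' 0 < s ''qn'' 0" "s ''st'' 0 = 0" "s ''len'' 0 < M"
    and val: "valid_flow (flow_of s)"
  shows "runs\<^sub>0 scan s 50 (\<lambda>s'. searching s' \<and> outer s' = outer s \<and> s' ''rd'' 0 = s ''rd'' 0 \<and>
    (s' ''len'' 0 = Suc (s ''len'' 0) \<and> s' ''qh'' 0 = s ''qh'' 0 \<or>
     s' ''len'' 0 = s ''len'' 0 \<and> s' ''qh'' 0 = Suc (s ''qh'' 0)))"
proof (rule runs_ev)
  show "straight scan" "cost scan \<le> 50"
    by (simp_all add: scan_def load_incidence_def advance_def visit_def)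
  have b: "bfs (flow_of s) (s ''rd'' 0) (s ''q'') (s ''qn'' 0) (s ''pv'') (s ''pe'') (s ''ex'')
     (s ''qh'' 0) (s ''j'' 0) (s ''l'' 0) (s ''len'' 0) (s ''log'')"
    and e: "env s" and vis: "\<And>x. s ''vis'' x = s ''rd'' 0 \<longleftrightarrow> x \<in> queue s"
    and QB: "queue s \<inter> B = {}"
    using s g by (auto simp: searching_def bfs_of_def)
  show "searching (ev\<^sub>0 scan s) \<and> outer (ev\<^sub>0 scan s) = outer s \<and> ev\<^sub>0 scan s ''rd'' 0 = s ''rd'' 0 \<and>
    (ev\<^sub>0 scan s ''len'' 0 = Suc (s ''len'' 0) \<and> ev\<^sub>0 scan s ''qh'' 0 = s ''qh'' 0 \<or>
     ev\<^sub>0 scan s ''len'' 0 = s ''len'' 0 \<and> ev\<^sub>0 scan s ''qh'' 0 = Suc (s ''qh'' 0))"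
  proof (cases "s ''j'' 0 < dg (s ''q'' (s ''qh'' 0))")
    case False
    define s' where "s' = ev\<^sub>0 scan s"
    have s': "s' ''qh'' = (s ''qh'')(0 := Suc (s ''qh'' 0))" "s' ''j'' = (s ''j'')(0 := 0)"
      "y \<notin> {''qh'', ''j''} \<Longrightarrow> s' y = s y" for y
      using False by (auto simp: s'_def scan_def store_upd_apply)
    have "flow_of s' = flow_of s" by (rule flow_of_cong) (simp_all add: s')
    then have "bfs_of s'"
      unfolding bfs_of_def using bfs_next_vertex[OF b g(1) False] by (simp add: s')
    moreover have "queue s' = queue s" by (simp add: queue_def s')
    ultimately show ?thesis
      using s g(2) QB unfolding s'_def[symmetric] by (simp add: s' searching_def env_def outer_def)
  next
    case True
    define s0 where "s0 = ev\<^sub>0 load_incidence s"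
    note c0 = ev_load_incidence[OF s0_def]
    define s1 where "s1 = ev\<^sub>0 advance s0"
    have flow0: "flow_of s0 = flow_of s" by (rule flow_of_cong) (simp_all add: c0)
    have adv: "scan_step (flow_of s) (s ''rd'' 0) (s ''q'' (s ''qh'' 0))
      (inc (s ''q'' (s ''qh'' 0)) (s ''j'' 0)) (s ''ex'') (s ''j'' 0) (s ''l'' 0)
       (s1 ''x'' 0) (s1 ''y'' 0) (s1 ''ex'') (s1 ''j'' 0) (s1 ''l'' 0)"
      using ev_advance(1)[OF s1_def] by (simp add: c0 flow0)
    have c1: "s1 ''v'' 0 = s ''q'' (s ''qh'' 0)"
      "s1 ''e'' 0 = inc (s ''q'' (s ''qh'' 0)) (s ''j'' 0)"
      "y \<notin> {''v'', ''e'', ''x'', ''y'', ''ex'', ''j'', ''l''} \<Longrightarrow> s1 y = s y" for y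
      using ev_advance(2)[OF s1_def] by (simp_all add: c0)
    define s2 where "s2 = ev\<^sub>0 (Seq (Assign ''log'' (var ''len'') (var ''y'')) (incr ''len'')) s1"
    have c2: "s2 ''log'' = (s1 ''log'')(s1 ''len'' 0 := s1 ''y'' 0)"
      "s2 ''len'' = (s1 ''len'')(0 := Suc (s1 ''len'' 0))"
      "y \<notin> {''log'', ''len''} \<Longrightarrow> s2 y = s1 y" for y
      by (auto simp: s2_def store_upd_apply)
    have q2: "queue s2 = queue s" by (simp add: queue_def c1 c2)
    define s3 where "s3 = ev\<^sub>0 visit s2"
    have vis2: "s2 ''vis'' x = s2 ''rd'' 0 \<longleftrightarrow> x \<in> queue s2" for x
      by (simp add: q2 c1 c2 vis)
    note c3 = ev_visit[OF s3_def vis2]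
    have "ev\<^sub>0 scan s = s3"
      using True by (simp add: scan_def s3_def s2_def s1_def s0_def)
    have flow: "flow_of s3 = flow_of s" by (rule flow_of_cong) (simp_all add: c1 c2 c3)
    have vs: "visit_step (s ''q'' (s ''qh'' 0)) (inc (s ''q'' (s ''qh'' 0)) (s ''j'' 0)) (s1 ''x'' 0)
      (s ''q'') (s ''qn'' 0) (s ''pv'') (s ''pe'') (s3 ''q'') (s3 ''qn'' 0) (s3 ''pv'') (s3 ''pe'')"
      using c3(1) by (simp add: c2 c1)
    have b3: "bfs (flow_of s) (s ''rd'' 0) (s3 ''q'') (s3 ''qn'' 0) (s3 ''pv'') (s3 ''pe'') (s1 ''ex'')
        (s ''qh'' 0) (s1 ''j'' 0) (s1 ''l'' 0) (Suc (s ''len'' 0)) ((s ''log'')(s ''len'' 0 := s1 ''y'' 0))"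
      and x3: "s1 ''x'' 0 \<in> queue s3" and q3: "queue s3 = insert (s1 ''x'' 0) (queue s)"
      using bfs_scan[OF b val g(1) True adv vs] by (auto simp: queue_def)
    have "s3 ''log'' = (s ''log'')(s ''len'' 0 := s1 ''y'' 0)"
      by (simp add: c3 c2 c1 del: fun_upd_apply)
    moreover have "s3 ''len'' 0 = Suc (s ''len'' 0)"
      "s3 ''rd'' 0 = s ''rd'' 0" "s3 ''ex'' = s1 ''ex''" "s3 ''qh'' 0 = s ''qh'' 0"
      "s3 ''j'' 0 = s1 ''j'' 0" "s3 ''l'' 0 = s1 ''l'' 0"
      by (simp_all add: c3 c2 c1)
    ultimately have "bfs_of s3"
      unfolding bfs_of_def flow using b3 by (simp only:)
    moreover have "env s3"
    proof -
      have "s1 ''ex'' e \<le> s ''rd'' 0" for e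
        using adv e by (auto simp: scan_step_def env_def split: if_splits)
      then show ?thesis using e by (auto simp: env_def c1 c2 c3)
    qed
    moreover have "s3 ''vis'' x = s3 ''rd'' 0 \<longleftrightarrow> x \<in> queue s3" for x
      unfolding q3 using vis by (simp add: c1 c2 c3)
    moreover have "if s3 ''st'' 0 = 0 then queue s3 \<inter> B = {} else s3 ''x'' 0 \<in> B \<inter> queue s3"
      using QB x3 g(2) unfolding q3 by (auto simp: c1 c2 c3 q2)
    ultimately show ?thesis
      unfolding \<open>ev\<^sub>0 scan s = s3\<close> using g(3) by (auto simp: searching_def outer_def c1 c2 c3)
  qed
qed

lemma runs_init_roots:
  assumes e: "env s" and q: "s ''qn'' 0 = 0" and v: "\<And>x. s ''vis'' x < s ''rd'' 0"
  shows "runs\<^sub>0 init_roots s (8 * Suc (length xs)) (\<lambda>s'.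
    (\<forall>y. y \<notin> {''vis'', ''pv'', ''q'', ''qn''} \<longrightarrow> s' y = s y) \<and> s' ''qn'' 0 = length xs \<and>
    (\<forall>i<length xs. s' ''q'' i = xs ! i \<and> s' ''pv'' (xs ! i) = xs ! i) \<and>
    (\<forall>x. s' ''vis'' x \<le> s ''rd'' 0) \<and> (\<forall>x. s' ''vis'' x = s ''rd'' 0 \<longleftrightarrow> x \<in> A))"
proof -
  define I where "I = (\<lambda>i s'. i + s' ''qn'' 0 = length xs \<and>
    (\<forall>y. y \<notin> {''vis'', ''pv'', ''q'', ''qn''} \<longrightarrow> s' y = s y) \<and>
    (\<forall>i<s' ''qn'' 0. s' ''q'' i = xs ! i \<and> s' ''pv'' (xs ! i) = xs ! i) \<and>
    (\<forall>x. s' ''vis'' x \<le> s ''rd'' 0) \<and> (\<forall>x. s' ''vis'' x = s ''rd'' 0 \<longleftrightarrow> (\<exists>i<s' ''qn'' 0. x = xs ! i)))"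
  have *: "runs\<^sub>0 init_roots s (Suc 7 * Suc (length xs)) (\<lambda>s'. \<exists>i. I i s' \<and>
      \<not> bval R B s' (Less (var ''qn'') (var ''lenA'')))"
    unfolding init_roots_def
  proof (rule runs_While, rule runs_evI)
    fix i s' s'' assume I: "I i s'" and b: "bval R B s' (Less (var ''qn'') (var ''lenA''))"
      and s''_def: "s'' = ev\<^sub>0 (Seq (Assign ''vis'' (Get ''A'' (var ''qn'')) (var ''rd''))
      (Seq (Assign ''pv'' (Get ''A'' (var ''qn'')) (Get ''A'' (var ''qn'')))
      (Seq (Assign ''q'' (var ''qn'') (Get ''A'' (var ''qn''))) (incr ''qn'')))) s'"
    have fr: "s' ''A'' = lookup xs" "s' ''rd'' = s ''rd''" "s' ''lenA'' 0 = length xs"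
      using I e unfolding I_def env_def by auto
    have lt: "s' ''qn'' 0 < length xs" using b fr by simp
    then have A: "lookup xs (s' ''qn'' 0) = xs ! (s' ''qn'' 0)" by (simp add: lookup_def)
    have s'': "s'' ''vis'' = (s' ''vis'')(xs ! s' ''qn'' 0 := s ''rd'' 0)"
      "s'' ''pv'' = (s' ''pv'')(xs ! s' ''qn'' 0 := xs ! s' ''qn'' 0)"
      "s'' ''q'' = (s' ''q'')(s' ''qn'' 0 := xs ! s' ''qn'' 0)"
      "s'' ''qn'' = (s' ''qn'')(0 := Suc (s' ''qn'' 0))"
      "y \<notin> {''vis'', ''pv'', ''q'', ''qn''} \<Longrightarrow> s'' y = s' y" for y
      by (simp_all add: s''_def store_upd_apply A fr)
    have "I (i - 1) s''"
      unfolding I_def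
    proof (intro conjI allI impI)
      fix y assume "y \<notin> {''vis'', ''pv'', ''q'', ''qn''}"
      then show "s'' y = s y" using I s''(5)[of y] unfolding I_def by simp
    next
      fix k assume k: "k < s'' ''qn'' 0"
      then have "k < s' ''qn'' 0 \<or> k = s' ''qn'' 0" by (auto simp: s''(4))
      then show "s'' ''q'' k = xs ! k" "s'' ''pv'' (xs ! k) = xs ! k"
        using I unfolding I_def s''(2,3) by auto
    next
      fix x
      show "s'' ''vis'' x \<le> s ''rd'' 0" using I unfolding I_def s''(1) by auto
      show "s'' ''vis'' x = s ''rd'' 0 \<longleftrightarrow> (\<exists>k<s'' ''qn'' 0. x = xs ! k)"
        using I unfolding I_def s''(1,4) by (auto simp: less_Suc_eq)
    next
      show "i - 1 + s'' ''qn'' 0 = length xs" using I lt unfolding I_def s''(4) by auto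
    qed
    moreover have "i - 1 < i" using I lt by (auto simp: I_def)
    ultimately show "\<exists>i'<i. I i' s''" by blast
  next
    show "I (length xs) s" using q v by (simp add: I_def less_imp_le less_imp_neq)
  qed (simp_all (no_asm))
  show ?thesis
  proof (rule runs_mono[OF *])
    fix s' assume "\<exists>i. I i s' \<and> \<not> bval R B s' (Less (var ''qn'') (var ''lenA''))"
    then obtain i where I: "I i s'" and b: "\<not> s' ''qn'' 0 < s' ''lenA'' 0" by auto
    have "s' ''lenA'' 0 = length xs" using I e by (simp add: I_def env_def)
    then have qn: "s' ''qn'' 0 = length xs" using I b by (simp add: I_def)
    have "x \<in> A \<longleftrightarrow> (\<exists>i<length xs. x = xs ! i)" for x
      using xs by (auto simp: in_set_conv_nth)
    then show "(\<forall>y. y \<notin> {''vis'', ''pv'', ''q'', ''qn''} \<longrightarrow> s' y = s y) \<and> s' ''qn'' 0 = length xs \<and>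
      (\<forall>i<length xs. s' ''q'' i = xs ! i \<and> s' ''pv'' (xs ! i) = xs ! i) \<and>
      (\<forall>x. s' ''vis'' x \<le> s ''rd'' 0) \<and> (\<forall>x. s' ''vis'' x = s ''rd'' 0 \<longleftrightarrow> x \<in> A)"
      using I unfolding I_def qn by simp
  qed auto
qed

text \<open>There are at most \<open>M\<close> logging steps, and \<open>qh\<close> advances at most
  \<open>length xs + M\<close> times because the queue grows only together with the log.\<close>

lemma runs_search:
  assumes e: "env s" and val: "valid_flow (flow_of s)"
  shows "runs\<^sub>0 search s (100 * Suc (2 * M + length xs)) (\<lambda>s'. searching s' \<and> outer s' = outer s \<and>
    \<not> (s' ''qh'' 0 < s' ''qn'' 0 \<and> s' ''st'' 0 = 0 \<and> s' ''len'' 0 < M))"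
proof -
  define P1 where "P1 = (\<lambda>s'. s' = ev\<^sub>0 (incr ''rd'') s)"
  define P2 where "P2 = (\<lambda>s'. (\<forall>y. y \<notin> {''rd'', ''qn''} \<longrightarrow> s' y = s y) \<and>
    s' ''rd'' 0 = Suc (s ''rd'' 0) \<and> s' ''qn'' 0 = 0)"
  define P3 where "P3 = (\<lambda>s'. (\<forall>y. y \<notin> {''rd'', ''qn'', ''vis'', ''pv'', ''q''} \<longrightarrow> s' y = s y) \<and>
    s' ''rd'' 0 = Suc (s ''rd'' 0) \<and> s' ''qn'' 0 = length xs \<and>
    (\<forall>i<length xs. s' ''q'' i = xs ! i \<and> s' ''pv'' (xs ! i) = xs ! i) \<and>
    (\<forall>x. s' ''vis'' x \<le> s' ''rd'' 0) \<and> (\<forall>x. s' ''vis'' x = s' ''rd'' 0 \<longleftrightarrow> x \<in> A))"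
  define I where "I = (\<lambda>i s'. searching s' \<and> outer s' = outer s \<and>
    i + s' ''len'' 0 + s' ''qh'' 0 = 2 * M + length xs)"
  let ?b = "Conj (Less (var ''qh'') (var ''qn''))
            (Conj (Equal (var ''st'') (Const 0)) (Less (var ''len'') (var ''M'')))"
  have *: "runs\<^sub>0 search s (Suc (1 + Suc (1 + Suc (8 * Suc (length xs) + Suc (9 + Suc 50 * Suc (2 * M + length xs))))))
    (\<lambda>s'. \<exists>i. I i s' \<and> \<not> bval R B s' ?b)"
    unfolding search_def
  proof (rule runs_Seq[where ?P1.0 = P1])
    show "runs\<^sub>0 (incr ''rd'') s 1 P1" by (rule runs_ev) (simp_all add: P1_def)
    fix s1 assume s1: "P1 s1"
    show "runs\<^sub>0 (Seq (assign ''qn'' (Const 0)) (Seq init_roots (Seq (Seq (assign ''qh'' (Const 0))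
          (Seq (assign ''j'' (Const 0)) (Seq (assign ''l'' (Const 0)) (Seq (assign ''len'' (Const 0))
               (assign ''st'' (Const 0))))))
     (While ?b scan)))) s1 (Suc (1 + Suc (8 * Suc (length xs) + Suc (9 + Suc 50 * Suc (2 * M + length xs)))))
      (\<lambda>s'. \<exists>i. I i s' \<and> \<not> bval R B s' ?b)"
    proof (rule runs_Seq[where ?P1.0 = P2])
      show "runs\<^sub>0 (assign ''qn'' (Const 0)) s1 1 P2"
        by (rule runs_ev) (use s1 in \<open>simp_all add: P1_def P2_def store_upd_apply\<close>)
      fix s2 assume s2: "P2 s2"
      have e2: "env s2" using e s2 by (auto simp: env_def P2_def le_Suc_eq)
      show "runs\<^sub>0 (Seq init_roots (Seq (Seq (assign ''qh'' (Const 0))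
          (Seq (assign ''j'' (Const 0)) (Seq (assign ''l'' (Const 0)) (Seq (assign ''len'' (Const 0))
               (assign ''st'' (Const 0)))))) (While ?b scan))) s2
        (Suc (8 * Suc (length xs) + Suc (9 + Suc 50 * Suc (2 * M + length xs))))
        (\<lambda>s'. \<exists>i. I i s' \<and> \<not> bval R B s' ?b)"
      proof (rule runs_Seq[where ?P1.0 = P3])
        show "runs\<^sub>0 init_roots s2 (8 * Suc (length xs)) P3"
        proof (rule runs_mono[OF runs_init_roots[OF e2]])
          show "s2 ''qn'' 0 = 0" using s2 by (simp add: P2_def)
          show "s2 ''vis'' x < s2 ''rd'' 0" for x
            using s2 e by (simp add: P2_def env_def less_Suc_eq_le)
        qed (use s2 in \<open>auto simp: P2_def P3_def\<close>)
        fix s3 assume s3: "P3 s3"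
        show "runs\<^sub>0 (Seq (Seq (assign ''qh'' (Const 0)) (Seq (assign ''j'' (Const 0))
            (Seq (assign ''l'' (Const 0)) (Seq (assign ''len'' (Const 0)) (assign ''st'' (Const 0))))))
          (While ?b scan)) s3 (Suc (9 + Suc 50 * Suc (2 * M + length xs)))
          (\<lambda>s'. \<exists>i. I i s' \<and> \<not> bval R B s' ?b)"
        proof (rule runs_Seq[where ?P1.0 = "I (2 * M + length xs)"])
          let ?c = "Seq (assign ''qh'' (Const 0)) (Seq (assign ''j'' (Const 0))
            (Seq (assign ''l'' (Const 0)) (Seq (assign ''len'' (Const 0)) (assign ''st'' (Const 0)))))"
          show "runs\<^sub>0 ?c s3 9 (I (2 * M + length xs))"
          proof (rule runs_evI)
            fix s4 assume s4_def: "s4 = ev\<^sub>0 ?c s3"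
            have s4: "s4 ''qh'' 0 = 0" "s4 ''j'' 0 = 0" "s4 ''l'' 0 = 0" "s4 ''len'' 0 = 0" "s4 ''st'' 0 = 0"
              "y \<notin> {''qh'', ''j'', ''l'', ''len'', ''st''} \<Longrightarrow> s4 y = s3 y" for y
              by (simp_all add: s4_def store_upd_apply)
            have fr: "\<And>y. y \<notin> {''rd'', ''qn'', ''vis'', ''pv'', ''q''} \<Longrightarrow> s3 y = s y"
              and rd: "s3 ''rd'' 0 = Suc (s ''rd'' 0)" and qn: "s3 ''qn'' 0 = length xs"
              and q: "\<And>i. i < length xs \<Longrightarrow> s3 ''q'' i = xs ! i"
              and pv: "\<And>i. i < length xs \<Longrightarrow> s3 ''pv'' (xs ! i) = xs ! i"
              and vis_le: "\<And>x. s3 ''vis'' x \<le> s3 ''rd'' 0"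
              and vis: "\<And>x. s3 ''vis'' x = s3 ''rd'' 0 \<longleftrightarrow> x \<in> A"
              using s3 unfolding P3_def by blast+
            have ex: "s3 ''ex'' x < s3 ''rd'' 0" for x
              using e by (simp add: fr rd env_def less_Suc_eq_le)
            have out: "outer s4 = outer s" by (simp add: outer_def s4 fr)
            have env4: "env s4"
              using vis_le less_imp_le[OF ex] e by (simp add: env_def s4 fr)
            have "queue s4 = (!) xs ` {..<length xs}"
              unfolding queue_def by (intro image_cong) (simp_all add: s4 qn q)
            also have "\<dots> = A"
              using xs(2) by (metis image_set map_nth set_map atLeast_upt atLeast0LessThan)
            finally have qu: "queue s4 = A" .
            have "bfs (flow_of s4) (s4 ''rd'' 0) (s4 ''q'') (length xs) (s4 ''pv'')
                (s4 ''pe'') (s4 ''ex'') 0 0 0 0 (s4 ''log'')"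
            proof (rule bfs_init)
              fix x assume "x \<in> A"
              then obtain i where "i < length xs" "x = xs ! i" using xs(2) by (metis in_set_conv_nth)
              then show "s4 ''pv'' x = x" by (simp add: s4 pv)
            qed (simp_all add: s4 q ex)
            then have "bfs_of s4" by (simp add: bfs_of_def s4 qn)
            then have "searching s4"
              using env4 vis AB unfolding searching_def qu by (simp add: s4)
            then show "I (2 * M + length xs) s4"
              unfolding I_def using out by (simp add: s4)
          qed simp_all
          fix s4 assume s4: "I (2 * M + length xs) s4"
          show "runs\<^sub>0 (While ?b scan) s4 (Suc 50 * Suc (2 * M + length xs))
            (\<lambda>s'. \<exists>i. I i s' \<and> \<not> bval R B s' ?b)"
          proof (rule runs_While[where I = I])
            show "I (2 * M + length xs) s4" by (rule s4)
            fix i s' assume I: "I i s'" and "bval R B s' ?b"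
            then have g: "s' ''qh'' 0 < s' ''qn'' 0" "s' ''st'' 0 = 0" "s' ''len'' 0 < M"
              by (auto simp: I_def searching_def env_def)
            have se: "searching s'" and ou: "outer s' = outer s" using I by (auto simp: I_def)
            have "valid_flow (flow_of s')" using val outer_flow[OF ou] by simp
            note r = runs_scan[OF se g this]
            have "s' ''qn'' 0 \<le> length xs + s' ''len'' 0"
              using se by (simp add: searching_def bfs_of_def bfs_def)
            then have lt: "s' ''len'' 0 + s' ''qh'' 0 < 2 * M + length xs" using g by linarith
            show "runs\<^sub>0 scan s' 50 (\<lambda>s''. \<exists>i'<i. I i' s'')"
            proof (rule runs_mono[OF r])
              fix s'' assume h: "searching s'' \<and> outer s'' = outer s' \<and> s'' ''rd'' 0 = s' ''rd'' 0 \<and>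
                (s'' ''len'' 0 = Suc (s' ''len'' 0) \<and> s'' ''qh'' 0 = s' ''qh'' 0 \<or>
                 s'' ''len'' 0 = s' ''len'' 0 \<and> s'' ''qh'' 0 = Suc (s' ''qh'' 0))"
              have ie: "i + s' ''len'' 0 + s' ''qh'' 0 = 2 * M + length xs"
                using I unfolding I_def by blast
              have i: "0 < i" using ie lt by linarith
              have "s'' ''len'' 0 + s'' ''qh'' 0 = Suc (s' ''len'' 0 + s' ''qh'' 0)"
                using h by auto
              then have "i - 1 + s'' ''len'' 0 + s'' ''qh'' 0 = 2 * M + length xs"
                using ie i by linarith
              then have "I (i - 1) s''" unfolding I_def using h ou by simp
              moreover have "i - 1 < i" using i by simp
              ultimately show "\<exists>i'<i. I i' s''" by blast
            qed simp
          qed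
        qed
      qed
    qed
  qed
  show ?thesis
    by (rule runs_mono[OF *]) (auto simp: I_def searching_def env_def)
qed

text \<open>Parents have smaller queue indices, so the index of the current vertex is the
  variant.\<close>

lemma runs_augment:
  assumes e: "env s" and t: "search_tree (flow_of s) (s ''q'') (s ''qn'' 0) (s ''pv'') (s ''pe'')"
    and f: "flow_ends (flow_of s) ts" and x: "i\<^sub>0 < s ''qn'' 0" "s ''x'' 0 = s ''q'' i\<^sub>0"
  shows "runs\<^sub>0 augment s (16 * Suc i\<^sub>0) (\<lambda>s'. env s' \<and> flow_ends (flow_of s') (s ''x'' 0 # ts) \<and>
    (\<forall>y. y \<notin> {''v'', ''e'', ''x'', ''fs'', ''tl'', ''hd''} \<longrightarrow> s' y = s y))"
proof -
  let ?b = "Neg (Equal (Get ''pv'' (var ''x'')) (var ''x''))"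
  define I where "I = (\<lambda>i s'. s' ''x'' 0 = s ''q'' i \<and> env s' \<and>
    augmenting (flow_of s) (s ''q'') (s ''qn'' 0) (s ''pv'') (s ''pe'') (s ''x'' 0) (flow_of s') i \<and>
    (\<forall>y. y \<notin> {''v'', ''e'', ''x'', ''fs'', ''tl'', ''hd''} \<longrightarrow> s' y = s y))"
  have *: "runs\<^sub>0 augment s (Suc 15 * Suc i\<^sub>0) (\<lambda>s'. \<exists>i. I i s' \<and> \<not> bval R B s' ?b)"
    unfolding augment_def
  proof (rule runs_While[where I = I], rule runs_evI)
    show "I i\<^sub>0 s" using augmenting_init[OF f x(1)] e x(2) by (simp add: I_def)
  next
    fix i s' s'' assume I: "I i s'" and b: "bval R B s' ?b"
      and s'': "s'' = ev\<^sub>0 (Seq (assign ''v'' (Get ''pv'' (var ''x'')))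
     (Seq (assign ''e'' (Get ''pe'' (var ''x'')))
     (Seq (IfElse (Equal (Get ''fs'' (var ''e'')) (var ''run''))
            (IfElse (Equal (Get ''hd'' (var ''e'')) (var ''v''))
              (Assign ''hd'' (var ''e'') (var ''x''))
              (Assign ''tl'' (var ''e'') (var ''v'')))
            (Seq (Assign ''fs'' (var ''e'') (var ''run''))
            (Seq (Assign ''tl'' (var ''e'') (var ''v''))
                 (Assign ''hd'' (var ''e'') (var ''x'')))))
          (assign ''x'' (var ''v''))))) s'"
    define s1 where "s1 = ev\<^sub>0 (Seq (assign ''v'' (Get ''pv'' (var ''x''))) (assign ''e'' (Get ''pe'' (var ''x'')))) s'"
    define s2 where "s2 = ev\<^sub>0 (IfElse (Equal (Get ''fs'' (var ''e'')) (var ''run''))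
            (IfElse (Equal (Get ''hd'' (var ''e'')) (var ''v''))
              (Assign ''hd'' (var ''e'') (var ''x''))
              (Assign ''tl'' (var ''e'') (var ''v'')))
            (Seq (Assign ''fs'' (var ''e'') (var ''run''))
            (Seq (Assign ''tl'' (var ''e'') (var ''v''))
                 (Assign ''hd'' (var ''e'') (var ''x''))))) s1"
    define s3 where "s3 = ev\<^sub>0 (assign ''x'' (var ''v'')) s2"
    have x': "s' ''x'' 0 = s ''q'' i" and pv': "s' ''pv'' = s ''pv''" "s' ''pe'' = s ''pe''"
      using I by (auto simp: I_def)
    have c1: "s1 ''v'' 0 = s ''pv'' (s ''q'' i)" "s1 ''e'' 0 = s ''pe'' (s ''q'' i)"
      "y \<notin> {''v'', ''e''} \<Longrightarrow> s1 y = s' y" for y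
      by (simp_all add: s1_def store_upd_apply x' pv')
    \<comment> \<open>The three branches of the program realise the three cases of
      \<open>push\<close>.\<close>
    have c2: "flow_of s2 = push (flow_of s1) (s1 ''v'' 0) (s1 ''e'' 0) (s1 ''x'' 0)"
    proof -
      define v e where "v = s1 ''v'' 0" and "e = s1 ''e'' 0"
      let ?u = "s1 ''fs'' e = s1 ''run'' 0" and ?h = "s1 ''hd'' e = v"
      consider "?u" "?h" | "?u" "\<not> ?h" | "\<not> ?u" by blast
      then show ?thesis
      proof cases
        case 1
        then have "s2 = store_upd s1 ''hd'' e (s1 ''x'' 0)" by (simp add: s2_def v_def e_def)
        with 1 show ?thesis
          unfolding v_def[symmetric] e_def[symmetric] by (intro ext) (simp add: flow_of_def push_def store_upd_apply)
      next
        case 2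
        then have "s2 = store_upd s1 ''tl'' e v" by (simp add: s2_def v_def e_def)
        with 2 show ?thesis
          unfolding v_def[symmetric] e_def[symmetric] by (intro ext) (simp add: flow_of_def push_def store_upd_apply)
      next
        case 3
        then have "s2 ''fs'' = (s1 ''fs'')(e := s1 ''run'' 0)" "s2 ''tl'' = (s1 ''tl'')(e := v)"
          "s2 ''hd'' = (s1 ''hd'')(e := s1 ''x'' 0)" "s2 ''run'' 0 = s1 ''run'' 0"
          by (simp_all add: s2_def v_def e_def store_upd_apply)
        with 3 show ?thesis
          unfolding v_def[symmetric] e_def[symmetric] by (intro ext) (simp add: flow_of_def push_def)
      qed
    qed
    have c2': "y \<notin> {''fs'', ''tl'', ''hd''} \<Longrightarrow> s2 y = s1 y"
      "s2 ''fs'' e = s1 ''fs'' e \<or> s2 ''fs'' e = s1 ''run'' 0" for y e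
      by (auto simp: s2_def store_upd_apply)
    have c3: "s3 ''x'' 0 = s2 ''v'' 0" "y \<noteq> ''x'' \<Longrightarrow> s3 y = s2 y" for y
      by (simp_all add: s3_def store_upd_apply)
    have "flow_of s1 = flow_of s'" by (rule flow_of_cong) (simp_all add: c1)
    moreover have "flow_of s3 = flow_of s2" by (rule flow_of_cong) (simp_all add: c3)
    ultimately have fl: "flow_of s3 = push (flow_of s') (s ''pv'' (s ''q'' i)) (s ''pe'' (s ''q'' i)) (s ''q'' i)"
      by (simp add: c2 c1 x')
    have "s ''pv'' (s ''q'' i) \<noteq> s ''q'' i" using b by (simp add: x' pv')
    then obtain i' where i': "i' < i" "s ''pv'' (s ''q'' i) = s ''q'' i'"
        "augmenting (flow_of s) (s ''q'') (s ''qn'' 0) (s ''pv'') (s ''pe'') (s ''x'' 0) (flow_of s3) i'"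
      using augmenting_step[OF t, of "s ''x'' 0" "flow_of s'" i] I unfolding fl I_def by blast
    have "env s3"
    proof -
      have "s3 ''fs'' e \<le> s3 ''run'' 0" for e
        using c2'(2)[of e] I by (auto simp: I_def env_def c1 c2'(1) c3)
      then show ?thesis using I e by (simp add: I_def env_def c1 c2'(1) c3)
    qed
    then have "I i' s3"
      unfolding I_def using i' I by (simp add: c1 c2'(1) c3 I_def)
    moreover have "s'' = s3"
      unfolding s'' s3_def s2_def s1_def ev.simps(4) ..
    ultimately show "\<exists>i'<i. I i' s''" using i'(1) by blast
  qed (simp_all (no_asm))
  show ?thesis
  proof (rule runs_mono[OF *])
    fix s' assume "\<exists>i. I i s' \<and> \<not> bval R B s' ?b"
    then obtain i where I: "I i s'" and b: "\<not> bval R B s' ?b" by blast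
    then have "s ''pv'' (s ''q'' i) = s ''q'' i" by (simp add: I_def)
    then have "flow_ends (flow_of s') (s ''x'' 0 # ts)"
      using I unfolding I_def by (blast intro: augmenting_done[OF t f])
    then show "env s' \<and> flow_ends (flow_of s') (s ''x'' 0 # ts) \<and>
      (\<forall>y. y \<notin> {''v'', ''e'', ''x'', ''fs'', ''tl'', ''hd''} \<longrightarrow> s' y = s y)"
      using I unfolding I_def by blast
  qed simp
qed

lemma runs_emit:
  "runs\<^sub>0 emit s (10 + 5 * s ''qn'' 0) (\<lambda>s'. (\<forall>y. y \<notin> {''best'', ''lenout'', ''out''} \<longrightarrow> s' y = s y) \<and>
    s' ''best'' 0 = s ''f'' 0 \<and> s' ''out'' ` {..<s' ''lenout'' 0} = queue s)"
proof -
  let ?b = "Less (var ''lenout'') (var ''qn'')"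
  define I where "I = (\<lambda>i s'. (\<forall>y. y \<notin> {''best'', ''lenout'', ''out''} \<longrightarrow> s' y = s y) \<and>
    s' ''best'' 0 = s ''f'' 0 \<and> i + s' ''lenout'' 0 = s ''qn'' 0 \<and>
    (\<forall>i<s' ''lenout'' 0. s' ''out'' i = s ''q'' i))"
  have *: "runs\<^sub>0 emit s (Suc (1 + Suc (1 + Suc 3 * Suc (s ''qn'' 0)))) (\<lambda>s'. \<exists>i. I i s' \<and> \<not> bval R B s' ?b)"
    unfolding emit_def
  proof (rule runs_Seq[where ?P1.0 = "\<lambda>s'. s' = ev\<^sub>0 (assign ''best'' (var ''f'')) s"])
    show "runs\<^sub>0 (assign ''best'' (var ''f'')) s 1 (\<lambda>s'. s' = ev\<^sub>0 (assign ''best'' (var ''f'')) s)"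
      by (rule runs_ev) simp_all
    fix s1 assume s1: "s1 = ev\<^sub>0 (assign ''best'' (var ''f'')) s"
    show "runs\<^sub>0 (Seq (assign ''lenout'' (Const 0)) (While ?b
       (Seq (Assign ''out'' (var ''lenout'') (Get ''q'' (var ''lenout''))) (incr ''lenout'')))) s1
       (Suc (1 + Suc 3 * Suc (s ''qn'' 0))) (\<lambda>s'. \<exists>i. I i s' \<and> \<not> bval R B s' ?b)"
    proof (rule runs_Seq[where ?P1.0 = "I (s ''qn'' 0)"])
      show "runs\<^sub>0 (assign ''lenout'' (Const 0)) s1 1 (I (s ''qn'' 0))"
        by (rule runs_ev) (simp_all add: s1 I_def store_upd_apply)
      fix s2 assume s2: "I (s ''qn'' 0) s2"
      show "runs\<^sub>0 (While ?b
         (Seq (Assign ''out'' (var ''lenout'') (Get ''q'' (var ''lenout''))) (incr ''lenout''))) s2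
         (Suc 3 * Suc (s ''qn'' 0)) (\<lambda>s'. \<exists>i. I i s' \<and> \<not> bval R B s' ?b)"
      proof (rule runs_While[where I = I])
        show "I (s ''qn'' 0) s2" by (rule s2)
        fix i s' assume I: "I i s'" and b: "bval R B s' ?b"
        show "runs\<^sub>0 (Seq (Assign ''out'' (var ''lenout'') (Get ''q'' (var ''lenout''))) (incr ''lenout''))
          s' 3 (\<lambda>s'. \<exists>i'<i. I i' s')"
        proof (rule runs_evI)
          fix s'' assume s''_def: "s'' = ev\<^sub>0 (Seq (Assign ''out'' (var ''lenout'') (Get ''q'' (var ''lenout'')))
            (incr ''lenout'')) s'"
          have s'': "s'' ''out'' = (s' ''out'')(s' ''lenout'' 0 := s' ''q'' (s' ''lenout'' 0))"
            "s'' ''lenout'' 0 = Suc (s' ''lenout'' 0)" "y \<notin> {''lenout'', ''out''} \<Longrightarrow> s'' y = s' y" for y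
            by (simp_all add: s''_def store_upd_apply)
          have "s' ''lenout'' 0 < s ''qn'' 0" using I b by (simp add: I_def)
          then have "I (i - 1) s''" "i - 1 < i" using I by (auto simp: I_def s'' less_Suc_eq)
          then show "\<exists>i'<i. I i' s''" by blast
        qed (simp_all (no_asm))
      qed
    qed
  qed
  show ?thesis
  proof (rule runs_mono[OF *])
    fix s' assume "\<exists>i. I i s' \<and> \<not> bval R B s' ?b"
    then obtain i where I: "I i s'" and b: "\<not> s' ''lenout'' 0 < s' ''qn'' 0" by auto
    then have "s' ''lenout'' 0 = s ''qn'' 0" by (auto simp: I_def)
    then show "(\<forall>y. y \<notin> {''best'', ''lenout'', ''out''} \<longrightarrow> s' y = s y) \<and>
      s' ''best'' 0 = s ''f'' 0 \<and> s' ''out'' ` {..<s' ''lenout'' 0} = queue s"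
      using I by (auto simp: I_def queue_def)
  qed simp
qed

end


section \<open>Success probability and running time\<close>

context local_cut
begin

text \<open>A common unit of time: it exceeds the queue length, and constant multiples of it pay for
  a search, an augmentation and an output.\<close>

definition "D = Suc (2 * M + length xs)"

lemma D_pos: "0 < D" and D_gt: "k \<le> M + length xs \<Longrightarrow> k < D"
  by (simp_all add: D_def)

lemma env_cong:
  "env s \<Longrightarrow> (\<And>y. y \<in> {''A'', ''lenA'', ''k'', ''M'', ''vis'', ''rd'', ''ex'', ''fs'', ''run''} \<Longrightarrow> s' y = s y) \<Longrightarrow>
    env s'"
  by (simp add: env_def)

definition outset :: "store \<Rightarrow> nat set" where
  "outset s = s ''out'' ` {..<s ''lenout'' 0}"

text \<open>The credit \<open>p\<close> within one run of the flow computation, where \<open>w\<close> is the failure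
  probability of all later runs together.  As long as no path has ended in \<open>S\<close>, each of the
  remaining rounds fails with probability at most \<open>1 / (2 * K)\<close>.\<close>

definition credit :: "real \<Rightarrow> store \<Rightarrow> nat list \<Rightarrow> real \<Rightarrow> bool" where
  "credit w s ts p \<longleftrightarrow> outset s = S \<and> s ''best'' 0 = \<kappa> \<or>
     \<kappa> < s ''best'' 0 \<and>
       (p \<le> 1 - w \<or> set ts \<inter> S = {} \<and> p \<le> 1 - w * (real K - real (length ts)) / (2 * real K))"

text \<open>Each round that may still happen before \<open>f\<close> reaches \<open>best\<close>
  owns \<open>200 * D\<close> units; an output makes this difference zero. \<open>T\<close> is
  reserved for later runs.\<close>

definition round_inv :: "real \<Rightarrow> nat \<Rightarrow> nat \<Rightarrow> assn" where
  "round_inv w pw T s t p \<longleftrightarrow> env s \<and> s ''pow'' 0 = pw \<and> s ''best'' 0 \<le> K \<and> p \<le> 1 \<and>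
     200 * D * (s ''best'' 0 - s ''f'' 0) + 1 + T \<le> t \<and>
     (\<exists>ts. flow_ends (flow_of s) ts \<and> length ts = s ''f'' 0 \<and> credit w s ts p)"

text \<open>\<open>s\<^sub>0\<close> is the store left by the search and \<open>s\<close> the one in
  which an end has been fixed, so that both ways of fixing it are covered.\<close>

lemma wp_augment:
  assumes se: "searching s\<^sub>0" and s: "\<And>y. y \<notin> {''r'', ''x''} \<Longrightarrow> s y = s\<^sub>0 y"
    and x: "s ''x'' 0 \<in> queue s\<^sub>0" and f: "flow_ends (flow_of s\<^sub>0) ts" "length ts = s\<^sub>0 ''f'' 0"
    and best: "s\<^sub>0 ''f'' 0 < s\<^sub>0 ''best'' 0" "s\<^sub>0 ''best'' 0 \<le> K" and p: "p \<le> 1"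
    and pw: "s\<^sub>0 ''pow'' 0 = pw"
    and t: "16 * D + 2 + 200 * D * (s\<^sub>0 ''best'' 0 - Suc (s\<^sub>0 ''f'' 0)) + 1 + T \<le> t"
    and cr: "credit w s\<^sub>0 (s ''x'' 0 # ts) p"
  shows "wp R B S (Seq augment (incr ''f'')) (round_inv w pw T) s t p"
proof -
  have b: "bfs_of s\<^sub>0" and len: "s\<^sub>0 ''len'' 0 \<le> M" and e: "env s\<^sub>0"
    using se by (auto simp: searching_def)
  have qn: "s\<^sub>0 ''qn'' 0 < D"
    using b len by (intro D_gt) (simp add: bfs_of_def bfs_def)
  obtain i where i: "i < s\<^sub>0 ''qn'' 0" "s ''x'' 0 = s\<^sub>0 ''q'' i" using x by (auto simp: queue_def)
  have fl: "flow_of s = flow_of s\<^sub>0" by (rule flow_of_cong) (simp_all add: s)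
  have "runs\<^sub>0 augment s (16 * Suc i) (\<lambda>s'. env s' \<and> flow_ends (flow_of s') (s ''x'' 0 # ts) \<and>
    (\<forall>y. y \<notin> {''v'', ''e'', ''x'', ''fs'', ''tl'', ''hd''} \<longrightarrow> s' y = s y))"
  proof (rule runs_augment)
    show "env s" using e by (simp add: env_def s)
    show "search_tree (flow_of s) (s ''q'') (s ''qn'' 0) (s ''pv'') (s ''pe'')"
      unfolding fl using b by (simp add: bfs_of_def bfs_def s)
  qed (use f i fl in \<open>simp_all add: s\<close>)
  then have a: "runs\<^sub>0 augment s (16 * D) (\<lambda>s'. env s' \<and> flow_ends (flow_of s') (s ''x'' 0 # ts) \<and>
    (\<forall>y. y \<notin> {''v'', ''e'', ''x'', ''fs'', ''tl'', ''hd''} \<longrightarrow> s' y = s y))"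
    by (rule runs_mono) (use i(1) qn in auto)
  show ?thesis
  proof (rule wp_Seq)
    show "wp R B S augment (wp R B S (incr ''f'') (round_inv w pw T)) s (t - 1) p"
    proof (rule runs_wp[OF a])
      show "16 * D \<le> t - 1" using t by linarith
      fix s' t' assume s': "env s' \<and> flow_ends (flow_of s') (s ''x'' 0 # ts) \<and>
        (\<forall>y. y \<notin> {''v'', ''e'', ''x'', ''fs'', ''tl'', ''hd''} \<longrightarrow> s' y = s y)"
        and t': "t - 1 \<le> t' + 16 * D"
      define s'' where "s'' = store_upd s' ''f'' 0 (Suc (s' ''f'' 0))"
      have fr: "\<And>y. y \<notin> {''v'', ''e'', ''x'', ''fs'', ''tl'', ''hd''} \<Longrightarrow> s' y = s y"
        using s' by blast
      have s'': "s'' ''f'' 0 = Suc (s\<^sub>0 ''f'' 0)" "y \<noteq> ''f'' \<Longrightarrow> s'' y = s' y" for y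
        by (simp_all add: s''_def store_upd_apply fr s)
      have fl'': "flow_of s'' = flow_of s'" by (rule flow_of_cong) (simp_all add: s'')
      have "env s'" using s' by blast
      then have "env s''" by (rule env_cong) (auto simp: s'')
      moreover have "credit w s'' (s ''x'' 0 # ts) p"
        using cr by (simp add: credit_def outset_def s'' fr s)
      moreover have "200 * D * (s\<^sub>0 ''best'' 0 - Suc (s\<^sub>0 ''f'' 0)) + 1 + T \<le> t' - 1"
        using t t' by linarith
      ultimately have "round_inv w pw T s'' (t' - 1) p"
        unfolding round_inv_def fl'' using s' f p best pw
        by (intro conjI exI[of _ "s ''x'' 0 # ts"]) (simp_all add: s'' fr s)
      moreover have "0 < t'" using t t' by linarith
      ultimately show "wp R B S (incr ''f'') (round_inv w pw T) s' t' p"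
        by (intro wp_Assign) (simp_all add: s''_def)
    qed
  qed (use t in linarith)
qed

text \<open>At most a fraction \<open>1 / (2 * K)\<close> of the draws is bad, and each of them
  costs at most \<open>w\<close>. The average loss is thus at most \<open>w / (2 * K)\<close>,
  exactly the difference between the promises for \<open>f\<close> and \<open>Suc f\<close>
  ends.\<close>

lemma sample_average:
  fixes w p :: real
  assumes w: "0 \<le> w" and bad: "card {r. r < M \<and> P r} \<le> 2 * \<nu>" and f: "f < K"
    and p: "p \<le> 1 - w * (real K - real f) / (2 * real K)"
  shows "p \<le> (\<Sum>r<M. if P r then 1 - w else 1 - w * (real K - real (Suc f)) / (2 * real K)) / real M"
proof -
  define a where "a = (real K - real (Suc f)) / (2 * real K)"
  have K: "real K > 0" by simp
  have a: "0 \<le> a" using f by (simp add: a_def)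
  have eq: "(real K - real f) / (2 * real K) = a + 1 / (2 * real K)"
    using K by (simp add: a_def field_simps)
  let ?b = "card {r. r < M \<and> P r}"
  have "(\<Sum>r<M. if P r then 1 - w else 1 - w * a) = (\<Sum>r<M. (1 - w * a) - (if P r then w * (1 - a) else 0))"
    by (intro sum.cong) (auto simp: algebra_simps)
  also have "\<dots> = real M * (1 - w * a) - real ?b * (w * (1 - a))"
    by (simp add: sum_subtractf sum.If_cases Int_def)
  finally have sum: "(\<Sum>r<M. if P r then 1 - w else 1 - w * a) = real M * (1 - w * a) - real ?b * (w * (1 - a))" .
  \<comment> \<open>This is the origin of the factor 4 in \<open>M\<close>: a fraction
    \<open>1 / (2 * K)\<close> of the log amounts to \<open>2 * (\<nu> + 1)\<close> entries, no
    fewer than the bad ones.\<close>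
  have M: "real M / (2 * real K) = 2 * (real \<nu> + 1)"
    using K by (simp add: field_simps)
  have "real ?b * (w * (1 - a)) \<le> real ?b * (w * 1)"
    using w a by (intro mult_left_mono) auto
  also have "\<dots> \<le> (2 * (real \<nu> + 1)) * w"
    using bad w by (simp add: mult_right_mono)
  also have "\<dots> = real M * (w / (2 * real K))" unfolding M[symmetric] by simp
  finally have "real M * (1 - w * (a + 1 / (2 * real K))) \<le> real M * (1 - w * a) - real ?b * (w * (1 - a))"
    by (simp add: algebra_simps)
  moreover have "p \<le> 1 - w * (a + 1 / (2 * real K))" using p eq by (metis times_divide_eq_right)
  then have "real M * p \<le> real M * (1 - w * (a + 1 / (2 * real K)))" by (intro mult_left_mono) auto
  ultimately have "real M * p \<le> (\<Sum>r<M. if P r then 1 - w else 1 - w * a)"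
    unfolding sum by linarith
  then have "p \<le> (\<Sum>r<M. if P r then 1 - w else 1 - w * a) / real M"
    by (simp add: field_simps del: of_nat_mult)
  then show ?thesis unfolding a_def times_divide_eq_right .
qed

lemma wp_round:
  assumes ri: "round_inv w pw T s t p" and g: "s ''f'' 0 < s ''best'' 0" and w: "0 \<le> w"
  shows "0 < t \<and> wp R B S flow_round (round_inv w pw T) s (t - 1) p"
proof -
  obtain ts where e: "env s" and pw: "s ''pow'' 0 = pw" and best: "s ''best'' 0 \<le> K" and p: "p \<le> 1"
    and t: "200 * D * (s ''best'' 0 - s ''f'' 0) + 1 + T \<le> t"
    and f: "flow_ends (flow_of s) ts" "length ts = s ''f'' 0" and cr: "credit w s ts p"
    using ri unfolding round_inv_def by blast
  define T' where "T' = 200 * D * (s ''best'' 0 - Suc (s ''f'' 0)) + 1 + T"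
  have tT: "T' + 200 * D \<le> t"
  proof -
    have "s ''best'' 0 - s ''f'' 0 = Suc (s ''best'' 0 - Suc (s ''f'' 0))" using g by simp
    then show ?thesis using t unfolding T'_def by (simp only: mult_Suc_right)
  qed
  have val: "valid_flow (flow_of s)" using f by (simp add: flow_ends_def)
  define Q where "Q = round_inv w pw T"
  have "wp R B S flow_round Q s (t - 1) p"
    unfolding flow_round_def
  proof (rule wp_Seq, goal_cases)
    case 1
    show ?case using tT D_pos by linarith
  next
    case 2
    show ?case
    proof (rule runs_wp[OF runs_search[OF e val, folded D_def]])
      show "100 * D \<le> t - 1 - 1" using tT D_pos by linarith
      fix s' t' assume s'': "searching s' \<and> outer s' = outer s \<and>
          \<not> (s' ''qh'' 0 < s' ''qn'' 0 \<and> s' ''st'' 0 = 0 \<and> s' ''len'' 0 < M)"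
        and t'': "t - 1 - 1 \<le> t' + 100 * D"
      have se: "searching s'" and ou: "outer s' = outer s" using s'' by auto
      have t': "T' + 90 * D \<le> t'" using t'' tT D_pos by linarith
      have b: "bfs_of s'" and e': "env s'" and len: "s' ''len'' 0 \<le> M" using se by (auto simp: searching_def)
      have fl: "flow_of s' = flow_of s" by (rule outer_flow[OF ou])
      have o: "s' ''best'' 0 = s ''best'' 0" "s' ''pow'' 0 = s ''pow'' 0" "s' ''f'' 0 = s ''f'' 0"
        "outset s' = outset s"
        using ou by (simp_all add: outer_def outset_def)
      have f': "flow_ends (flow_of s') ts" "length ts = s' ''f'' 0" using f fl o by simp_all
      have cr': "credit w s' ts p" using cr o by (simp add: credit_def)
      have qn: "s' ''qn'' 0 < D"
        using b len by (intro D_gt) (simp add: bfs_of_def bfs_def)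
      have M': "s' ''M'' 0 = M" using e' by (simp add: env_def)
      show "wp R B S (IfElse (Conj (Equal (var ''st'') (Const 0)) (Neg (Less (var ''qh'') (var ''qn''))))
         emit
         (Seq (IfElse (Equal (var ''st'') (Const 0))
                (Seq (Sample ''r'' (Const 0) (var ''M'')) (assign ''x'' (Get ''log'' (var ''r''))))
                Skip)
              (Seq augment (incr ''f'')))) Q s' t' p"
      proof (rule wp_IfElse)
        show "0 < t'" using t' D_pos by linarith
        show "wp R B S (if bval R B s' (Conj (Equal (var ''st'') (Const 0)) (Neg (Less (var ''qh'') (var ''qn''))))
          then emit else Seq (IfElse (Equal (var ''st'') (Const 0))
                (Seq (Sample ''r'' (Const 0) (var ''M'')) (assign ''x'' (Get ''log'' (var ''r''))))
                Skip) (Seq augment (incr ''f''))) Q s' (t' - 1) p"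
        proof (cases "s' ''st'' 0 = 0 \<and> \<not> s' ''qh'' 0 < s' ''qn'' 0")
          case True
          have "s' ''qh'' 0 = s' ''qn'' 0"
            using True b by (simp add: bfs_of_def bfs_def explored_def)
          then have cl: "closed_set (flow_of s') (queue s')"
            using b bfs_closed unfolding bfs_of_def queue_def by metis
          have tr: "search_tree (flow_of s') (s' ''q'') (s' ''qn'' 0) (s' ''pv'') (s' ''pe'')"
            and AX: "A \<subseteq> queue s'" using b by (simp_all add: bfs_of_def bfs_def queue_def)
          have X: "queue s' \<subseteq> {..<n}" using tr by (simp add: search_tree_def queue_def)
          have XB: "queue s' \<inter> B = {}" using se True by (simp add: searching_def)
          note ge = closed_ge[OF f'(1) X AX XB cl]
          \<comment> \<open>\<open>closed_ge\<close> shows that \<open>S\<close> lies in the queue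
            and is itself closed, so the search cannot have left it.\<close>
          have XS: "queue s' = S" if "length ts = \<kappa>"
            using ge(2)[OF that] search_tree_reach[OF tr S_props(1)] by (auto simp: queue_def)
          have "wp R B S emit Q s' (t' - 1) p"
          proof (rule runs_wp[OF runs_emit])
            show "10 + 5 * s' ''qn'' 0 \<le> t' - 1" using t' qn by linarith
            fix s2 t2 assume s2: "(\<forall>y. y \<notin> {''best'', ''lenout'', ''out''} \<longrightarrow> s2 y = s' y) \<and>
              s2 ''best'' 0 = s' ''f'' 0 \<and> s2 ''out'' ` {..<s2 ''lenout'' 0} = queue s'"
              and t2: "t' - 1 \<le> t2 + (10 + 5 * s' ''qn'' 0)"
            have fr: "\<And>y. y \<notin> {''best'', ''lenout'', ''out''} \<Longrightarrow> s2 y = s' y"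
              and best2: "s2 ''best'' 0 = s' ''f'' 0" and out2: "outset s2 = queue s'"
              using s2 by (auto simp: outset_def)
            have "env s2" using e' by (rule env_cong) (auto simp: fr)
            moreover have "flow_of s2 = flow_of s'" by (rule flow_of_cong) (simp_all add: fr)
            moreover have "credit w s2 ts p"
            proof (cases "length ts = \<kappa>")
              case True
              then show ?thesis using XS f' by (simp add: credit_def best2 out2)
            next
              case False
              \<comment> \<open>An output after more than \<open>\<kappa>\<close> paths keeps
                \<open>best\<close> above \<open>\<kappa>\<close>, so the credit carries over; since
                \<open>f < best\<close>, a correct output is never overwritten.\<close>
              then have "\<kappa> < s' ''f'' 0" using ge(1) f'(2) by simp
              then show ?thesis using cr' g by (auto simp: credit_def best2 out2 o)
            qed
            moreover have "1 + T \<le> t2" using t' t2 qn unfolding T'_def by linarith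
            ultimately show "Q s2 t2 p"
              unfolding Q_def round_inv_def using f' p pw best g
              by (intro conjI exI[of _ ts]) (simp_all add: best2 fr o)
          qed
          then show ?thesis using True by simp
        next
          case nc: False
          define P where "P = (\<lambda>s2 t2 p2. (\<forall>y. y \<notin> {''r'', ''x''} \<longrightarrow> s2 y = s' y) \<and>
             s2 ''x'' 0 \<in> queue s' \<and> p2 \<le> 1 \<and> 16 * D + 2 + T' \<le> t2 \<and> credit w s' (s2 ''x'' 0 # ts) p2)"
          have cont: "wp R B S (Seq augment (incr ''f'')) Q s2 t2 p2" if "P s2 t2 p2" for s2 t2 p2
            unfolding Q_def
          proof (rule wp_augment[OF se])
            show "16 * D + 2 + 200 * D * (s' ''best'' 0 - Suc (s' ''f'' 0)) + 1 + T \<le> t2"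
              using that unfolding P_def T'_def o by linarith
          qed (use that f' g best pw in \<open>auto simp: P_def o\<close>)
          have "wp R B S (IfElse (Equal (var ''st'') (Const 0))
                (Seq (Sample ''r'' (Const 0) (var ''M'')) (assign ''x'' (Get ''log'' (var ''r''))))
                Skip) P s' (t' - 1 - 1) p"
          proof (rule wp_IfElse)
            show "0 < t' - 1 - 1" using t' D_pos by linarith
            show "wp R B S (if bval R B s' (Equal (var ''st'') (Const 0))
              then Seq (Sample ''r'' (Const 0) (var ''M'')) (assign ''x'' (Get ''log'' (var ''r'')))
              else Skip) P s' (t' - 1 - 1 - 1) p"
            proof (cases "s' ''st'' 0 = 0")
              case False
              then have x: "s' ''x'' 0 \<in> B \<inter> queue s'" using se by (simp add: searching_def)
              have "credit w s' (s' ''x'' 0 # ts) p"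
              proof -
                \<comment> \<open>An end in \<open>B\<close> is never bad, so this round consumes
                  none of its failure allowance.\<close>
                have xS: "s' ''x'' 0 \<notin> S" using x S_props(2) by auto
                have "w * (real K - real (Suc (length ts))) / (2 * real K) \<le> w * (real K - real (length ts)) / (2 * real K)"
                  using w by (intro divide_right_mono mult_left_mono) auto
                then show ?thesis using cr' xS by (auto simp: credit_def simp del: of_nat_Suc)
              qed
              then have "P s' (t' - 1 - 1 - 1 - 1) p" unfolding P_def using x p t' D_pos by auto
              then have "wp R B S Skip P s' (t' - 1 - 1 - 1) p"
                by (intro wp_Skip) (use t' D_pos in linarith)
              then show ?thesis using False by simp
            next
              case True
              then have qh: "s' ''qh'' 0 < s' ''qn'' 0" using nc by simp
              \<comment> \<open>Neither \<open>B\<close> was reached nor the queue exhausted, so the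
                loop stopped because the log is full, and every \<open>r < M\<close> is a valid
                entry.\<close>
              have len: "s' ''len'' 0 = M" using s'' True qh len by auto
              have lg: "s' ''log'' r \<in> queue s'" if "r < M" for r
                using b that len by (simp add: bfs_of_def bfs_def queue_def)
              have bad: "card {r. r < M \<and> s' ''log'' r \<in> S} \<le> 2 * \<nu>"
                using log_bound[OF b[unfolded bfs_of_def] qh] unfolding len .
              have "\<exists>g. p \<le> (\<Sum>r<M. g r) / real M \<and> (\<forall>r<M. g r \<le> 1 \<and> credit w s' (s' ''log'' r # ts) (g r))"
              \<comment> \<open>If \<open>S\<close> has been found, or \<open>p\<close> is already
                down to \<open>1 - w\<close>, any end keeps the credit and a constant promise
                suffices. Averaging is needed only while all ends avoid \<open>S\<close>.\<close>
              proof (cases "\<exists>x. \<not> credit w s' (x # ts) p")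
                case False
                have M0: "real M \<noteq> 0" unfolding of_nat_eq_0_iff by simp
                have "(\<Sum>r<M. p) / real M = p"
                  unfolding sum_constant card_lessThan by (rule nonzero_mult_div_cancel_left[OF M0])
                then show ?thesis using False p by (intro exI[of _ "\<lambda>_. p"]) auto
              next
                case True
                then have nf: "\<not> (outset s' = S \<and> s' ''best'' 0 = \<kappa>)" "\<not> p \<le> 1 - w" and bk: "\<kappa> < s' ''best'' 0"
                  using cr' by (auto simp: credit_def)
                then have good: "set ts \<inter> S = {}" "p \<le> 1 - w * (real K - real (length ts)) / (2 * real K)"
                  using cr' by (auto simp: credit_def)
                let ?g = "\<lambda>r. if s' ''log'' r \<in> S then 1 - w
                  else 1 - w * (real K - real (Suc (length ts))) / (2 * real K)"
                have fK: "length ts < K" using f(2) g best by simp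
                have "p \<le> (\<Sum>r<M. ?g r) / real M"
                  by (rule sample_average[OF w bad fK good(2)])
                moreover have "?g r \<le> 1 \<and> credit w s' (s' ''log'' r # ts) (?g r)" for r
                  using good(1) bk w fK by (auto simp: credit_def simp del: of_nat_Suc)
                ultimately show ?thesis by (intro exI[of _ ?g]) blast
              qed
              then obtain h where h: "p \<le> (\<Sum>r<M. h r) / real M"
                "\<And>r. r < M \<Longrightarrow> h r \<le> 1 \<and> credit w s' (s' ''log'' r # ts) (h r)" by blast
              have "wp R B S (Seq (Sample ''r'' (Const 0) (var ''M'')) (assign ''x'' (Get ''log'' (var ''r''))))
                P s' (t' - 1 - 1 - 1) p"
              proof (rule wp_Seq, goal_cases)
                case 1
                show ?case using t' D_pos by linarith
              next
                case 2
                have av: "aval R B s' (var ''M'') = M" using M' by simp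
                show ?case
                proof (rule wp_Sample[where g = h], unfold av)
                  show "0 < t' - 1 - 1 - 1 - 1" using t' D_pos by linarith
                  show "0 < M" by simp
                  show "p \<le> (\<Sum>r<M. h r) / real M" by (rule h(1))
                  fix r assume r: "r < M"
                  define s2 where "s2 = store_upd s' ''r'' (aval R B s' (Const 0)) r"
                  define s3 where "s3 = store_upd s2 ''x'' (aval R B s2 (Const 0)) (aval R B s2 (Get ''log'' (var ''r'')))"
                  have s3: "s3 ''x'' 0 = s' ''log'' r" "y \<notin> {''r'', ''x''} \<Longrightarrow> s3 y = s' y" for y
                    by (simp_all add: s3_def s2_def store_upd_apply)
                  have "16 * D + 2 + T' \<le> t' - 1 - 1 - 1 - 1 - 1 - 1" using t' D_pos by linarith
                  then have "P s3 (t' - 1 - 1 - 1 - 1 - 1 - 1) (h r)"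
                    unfolding P_def using h(2)[OF r] lg[OF r] by (simp add: s3)
                  moreover have "0 < t' - 1 - 1 - 1 - 1 - 1" using t' D_pos by linarith
                  ultimately show "wp R B S (assign ''x'' (Get ''log'' (var ''r''))) P
                    (store_upd s' ''r'' (aval R B s' (Const 0)) r) (t' - 1 - 1 - 1 - 1 - 1) (h r)"
                    unfolding s3_def s2_def by (rule wp_Assign[rotated])
                qed
              qed
              then show ?thesis using True by simp
            qed
          qed
          then have "wp R B S (Seq (IfElse (Equal (var ''st'') (Const 0))
                (Seq (Sample ''r'' (Const 0) (var ''M'')) (assign ''x'' (Get ''log'' (var ''r''))))
                Skip) (Seq augment (incr ''f''))) Q s' (t' - 1) p"
            by (intro wp_Seq) (use t' D_pos in linarith, erule wp_mono, erule cont)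
          then show ?thesis using nc by (simp only: bval.simps aval.simps if_False simp_thms)
        qed
      qed
    qed
  qed
  then show ?thesis using tT D_pos unfolding Q_def by auto
qed

section \<open>Amplification by repeated runs\<close>

definition run_time :: nat where
  "run_time = 20 + 200 * D * K"

text \<open>The failure allowance doubles together with \<open>pow\<close>, so runs are counted
  without computing a logarithm. The case \<open>n = 0\<close> is separate: no run takes place, and
  the empty initial output is already \<open>S\<close>.\<close>

definition outer_inv :: "nat \<Rightarrow> assn" where
  "outer_inv L s t p \<longleftrightarrow> env s \<and> s ''best'' 0 \<le> K \<and> p \<le> 1 \<and>
     (\<exists>j. s ''pow'' 0 = 2 ^ j \<and> run_time * (L - j) + 1 \<le> t \<and>
        (outset s = S \<and> (s ''best'' 0 = \<kappa> \<or> n = 0) \<or> \<kappa> < s ''best'' 0 \<and> p \<le> 1 - 2 ^ j / 2 ^ L))"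

definition final :: assn where
  "final s t p \<longleftrightarrow> p \<le> 1 \<and> (outset s = S \<or> p \<le> 0)"

lemma wp_run:
  assumes e: "env s" and best: "s ''best'' 0 \<le> K" and p: "p \<le> 1" and pow: "s ''pow'' 0 = 2 ^ j"
    and t: "run_time * (L - j) + 1 \<le> Suc t" and n: "n \<noteq> 0" and j: "j < L"
    and cr: "outset s = S \<and> s ''best'' 0 = \<kappa> \<or> \<kappa> < s ''best'' 0 \<and> p \<le> 1 - 2 ^ j / 2 ^ L"
  shows "wp R B S (Seq (assign ''pow'' (Plus (var ''pow'') (var ''pow'')))
       (Seq (incr ''run'') (Seq (assign ''f'' (Const 0))
       (While (Less (var ''f'') (var ''best'')) flow_round)))) (outer_inv L) s t p"
proof -
  define T where "T = run_time * (L - Suc j) + 1"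
  \<comment> \<open>\<open>w\<close> is the allowance left for the later runs. The \<open>K\<close>
    rounds of this run lose at most \<open>w / (2 * K)\<close> each, so entering it requires the
    promise \<open>1 - w / 2\<close>, which is the bound for \<open>j\<close>.\<close>
  define w :: real where "w = 2 ^ Suc j / 2 ^ L"
  have w: "0 \<le> w" by (simp add: w_def)
  have "L - j = Suc (L - Suc j)" using j by simp
  then have "T + run_time \<le> Suc t" using t unfolding T_def by simp
  then have t: "200 * D * K + 1 + T + 18 \<le> t" unfolding run_time_def by linarith
  define s1 where "s1 = store_upd s ''pow'' 0 (s ''pow'' 0 + s ''pow'' 0)"
  define s2 where "s2 = store_upd s1 ''run'' 0 (s1 ''run'' 0 + 1)"
  define s3 where "s3 = store_upd s2 ''f'' 0 0"
  have s3: "s3 ''pow'' 0 = 2 ^ Suc j" "s3 ''run'' 0 = Suc (s ''run'' 0)" "s3 ''f'' 0 = 0"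
    "y \<notin> {''pow'', ''run'', ''f''} \<Longrightarrow> s3 y = s y" for y
    by (simp_all add: s3_def s2_def s1_def store_upd_apply pow)
  have "s ''fs'' i < Suc (s ''run'' 0)" for i using e by (simp add: env_def less_Suc_eq_le)
  then have "flow_of s3 = (\<lambda>_. None)" by (simp add: flow_of_def s3 less_imp_neq)
  then have fl: "flow_ends (flow_of s3) []" using flow_ends_empty by simp
  have env3: "env s3" using e by (simp add: env_def s3 le_SucI)
  have w2: "w * (real K - real (length [])) / (2 * real K) = 2 ^ j / 2 ^ L"
    using nonzero_mult_div_cancel_right[of "real K" w] by (simp add: w_def del: of_nat_Suc)
  have "credit w s3 [] p"
    using cr unfolding credit_def w2 by (auto simp: s3 outset_def)
  moreover have "200 * D * s ''best'' 0 \<le> 200 * D * K" using best by (rule mult_le_mono2)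
  then have "200 * D * (s3 ''best'' 0 - s3 ''f'' 0) + 1 + T \<le> t - 6"
    using t by (simp add: s3)
  ultimately have ri: "round_inv w (2 ^ Suc j) T s3 (t - 6) p"
    unfolding round_inv_def using env3 fl best p
    by (intro conjI exI[of _ "[]"]) (simp_all add: s3)
  have loop: "wp R B S (While (Less (var ''f'') (var ''best'')) flow_round) (outer_inv L) s3 (t - 6) p"
  proof (rule wp_While[where I = "round_inv w (2 ^ Suc j) T"])
    show "round_inv w (2 ^ Suc j) T s3 (t - 6) p" by (rule ri)
    fix s' t' p' assume ri: "round_inv w (2 ^ Suc j) T s' t' p'"
    have out: "outer_inv L s' (t' - 1) p'" if nl: "\<not> s' ''f'' 0 < s' ''best'' 0"
    proof -
      obtain ts where ts: "flow_ends (flow_of s') ts" "length ts = s' ''f'' 0" and cr: "credit w s' ts p'"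
        and e: "env s'" "s' ''pow'' 0 = 2 ^ Suc j" "s' ''best'' 0 \<le> K" "p' \<le> 1" and t': "1 + T \<le> t'"
        using ri unfolding round_inv_def by (metis add.assoc add_leD2)
      \<comment> \<open>A run ends with \<open>f\<close> at least \<open>best\<close>. If all ends
        avoid \<open>S\<close> then \<open>f\<close> is at most \<open>\<kappa>\<close>, so
        \<open>best\<close> cannot exceed \<open>\<kappa>\<close>: a good run has found
        \<open>S\<close>.\<close>
      have "\<not> (set ts \<inter> S = {} \<and> \<kappa> < s' ''best'' 0)"
        using good_ends_le[OF ts(1)] ts(2) nl by auto
      then have "outset s' = S \<and> (s' ''best'' 0 = \<kappa> \<or> n = 0) \<or>
          \<kappa> < s' ''best'' 0 \<and> p' \<le> 1 - 2 ^ Suc j / 2 ^ L"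
        using cr unfolding credit_def w_def by blast
      moreover have "run_time * (L - Suc j) + 1 \<le> t' - 1" using t' unfolding T_def by linarith
      ultimately show ?thesis unfolding outer_inv_def using e by blast
    qed
    show "0 < t' \<and> (if bval R B s' (Less (var ''f'') (var ''best''))
        then wp R B S flow_round (round_inv w (2 ^ Suc j) T) s' (t' - 1) p'
        else outer_inv L s' (t' - 1) p')"
    proof (cases "s' ''f'' 0 < s' ''best'' 0")
      case True
      then show ?thesis using wp_round[OF ri True w] by simp
    next
      case False
      have "0 < t'" using ri by (simp add: round_inv_def)
      then show ?thesis using out[OF False] False by simp
    qed
  qed
  have "wp R B S (assign ''f'' (Const 0))
      (wp R B S (While (Less (var ''f'') (var ''best'')) flow_round) (outer_inv L)) s2 (t - 5) p"
    by (rule wp_Assign) (use t loop in \<open>simp_all add: s3_def\<close>)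
  then have "wp R B S (Seq (assign ''f'' (Const 0))
      (While (Less (var ''f'') (var ''best'')) flow_round)) (outer_inv L) s2 (t - 4) p"
    by (intro wp_Seq) (use t in simp_all)
  then have "wp R B S (incr ''run'') (wp R B S (Seq (assign ''f'' (Const 0))
      (While (Less (var ''f'') (var ''best'')) flow_round)) (outer_inv L)) s1 (t - 3) p"
    by (intro wp_Assign) (use t in \<open>simp_all add: s2_def\<close>)
  then have "wp R B S (Seq (incr ''run'') (Seq (assign ''f'' (Const 0))
      (While (Less (var ''f'') (var ''best'')) flow_round))) (outer_inv L) s1 (t - 2) p"
    by (intro wp_Seq) (use t in simp_all)
  then have "wp R B S (assign ''pow'' (Plus (var ''pow'') (var ''pow'')))
     (wp R B S (Seq (incr ''run'') (Seq (assign ''f'' (Const 0))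
      (While (Less (var ''f'') (var ''best'')) flow_round))) (outer_inv L)) s (t - 1) p"
    by (intro wp_Assign) (use t in \<open>simp_all add: s1_def numeral_2_eq_2\<close>)
  then show ?thesis by (intro wp_Seq) (use t in simp_all)
qed

lemma wp_runs:
  assumes inv: "outer_inv L s t p" and L: "\<And>j. 2 ^ j < n \<longleftrightarrow> j < L"
  shows "wp R B S (While (Less (var ''pow'') NumVerts)
       (Seq (assign ''pow'' (Plus (var ''pow'') (var ''pow'')))
       (Seq (incr ''run'') (Seq (assign ''f'' (Const 0))
       (While (Less (var ''f'') (var ''best'')) flow_round))))) final s t p"
proof (rule wp_While[where I = "outer_inv L"])
  show "outer_inv L s t p" by (rule inv)
  fix s t p assume "outer_inv L s t p"
  then obtain j where e: "env s" "s ''best'' 0 \<le> K" "p \<le> 1" and pow: "s ''pow'' 0 = 2 ^ j"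
    and t: "run_time * (L - j) + 1 \<le> t"
    and cr: "outset s = S \<and> (s ''best'' 0 = \<kappa> \<or> n = 0) \<or> \<kappa> < s ''best'' 0 \<and> p \<le> 1 - 2 ^ j / 2 ^ L"
    unfolding outer_inv_def by blast
  have b: "bval R B s (Less (var ''pow'') NumVerts) \<longleftrightarrow> j < L" using L pow by simp
  have t0: "0 < t" using t by linarith
  show "0 < t \<and> (if bval R B s (Less (var ''pow'') NumVerts)
      then wp R B S (Seq (assign ''pow'' (Plus (var ''pow'') (var ''pow'')))
       (Seq (incr ''run'') (Seq (assign ''f'' (Const 0))
       (While (Less (var ''f'') (var ''best'')) flow_round)))) (outer_inv L) s (t - 1) p
      else final s (t - 1) p)"
  proof (cases "j < L")
    case True
    then have n: "n \<noteq> 0" using L[of j] by auto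
    have "wp R B S (Seq (assign ''pow'' (Plus (var ''pow'') (var ''pow'')))
       (Seq (incr ''run'') (Seq (assign ''f'' (Const 0))
       (While (Less (var ''f'') (var ''best'')) flow_round)))) (outer_inv L) s (t - 1) p"
      by (rule wp_run[OF e pow _ n True]) (use t t0 cr n in auto)
    then show ?thesis using b True t0 by simp
  next
    case False
    \<comment> \<open>Once all runs are over, the remaining promise is at most 0 unless
      \<open>S\<close> has been output.\<close>
    then have "(1::real) \<le> 2 ^ j / 2 ^ L" by (simp add: power_increasing)
    then have "final s (t - 1) p" unfolding final_def using cr e(3) by linarith
    then show ?thesis using b False t0 by simp
  qed
qed

lemma wp_LocalMinCut:
  assumes t: "20 + 4 * Suc K + run_time * L \<le> t" and p: "p \<le> 1" "n \<noteq> 0 \<Longrightarrow> p \<le> 1 - 1 / 2 ^ L"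
    and L: "\<And>j. 2 ^ j < n \<longleftrightarrow> j < L"
  shows "wp R B S LocalMinCut final (init_store xs \<nu> c) t p"
proof -
  define s0 where "s0 = init_store xs \<nu> c"
  define s1 where "s1 = store_upd s0 ''k'' 0 (s0 ''c'' 0 + 1)"
  define s2 where "s2 = store_upd s1 ''best'' 0 (s1 ''k'' 0)"
  define s3 where "s3 = store_upd s2 ''pow'' 0 1"
  have s0: "s0 ''A'' = lookup xs" "s0 ''lenA'' 0 = length xs" "s0 ''nu'' 0 = \<nu>" "s0 ''c'' 0 = c"
    "y \<notin> {''A'', ''lenA'', ''nu'', ''c''} \<Longrightarrow> s0 y i = 0" for y i
    by (simp_all add: s0_def init_store_def)
  have s3: "s3 ''k'' 0 = K" "s3 ''best'' 0 = K" "s3 ''pow'' 0 = 1"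
    "y \<notin> {''k'', ''best'', ''pow''} \<Longrightarrow> s3 y = s0 y" for y
    by (simp_all add: s3_def s2_def s1_def store_upd_apply s0)
  let ?b = "Less (var ''i'') (var ''k'')"
  let ?body = "Seq (incr ''i'') (assign ''M'' (Plus (Plus (var ''M'') (Plus (var ''nu'') (var ''nu'')))
                    (Plus (Plus (var ''nu'') (var ''nu'')) (Const 4))))"
  define I where "I = (\<lambda>i s. i + s ''i'' 0 = K \<and> s ''M'' 0 = s ''i'' 0 * (4 * Suc \<nu>) \<and>
    (\<forall>y. y \<notin> {''i'', ''M''} \<longrightarrow> s y = s3 y))"
  have M: "runs\<^sub>0 (While ?b ?body) s3 (Suc 3 * Suc K) (\<lambda>s'. \<exists>i. I i s' \<and> \<not> bval R B s' ?b)"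
  proof (rule runs_While[where I = I], rule runs_evI)
    fix i s s' assume I: "I i s" and b: "bval R B s ?b" and s'_def: "s' = ev\<^sub>0 ?body s"
    have fr: "\<And>y. y \<notin> {''i'', ''M''} \<Longrightarrow> s y = s3 y" using I unfolding I_def by blast
    have s': "s' ''i'' 0 = Suc (s ''i'' 0)" "s' ''M'' 0 = s ''M'' 0 + 4 * Suc \<nu>"
      "y \<notin> {''i'', ''M''} \<Longrightarrow> s' y = s3 y" for y
      by (simp_all add: s'_def store_upd_apply fr s3 s0)
    have "s ''i'' 0 < K" using b by (simp add: fr s3)
    then have "I (i - 1) s'" "i - 1 < i" using I unfolding I_def by (auto simp: s')
    then show "\<exists>i'<i. I i' s'" by blast
  next
    show "I K s3" by (simp add: I_def s3 s0)
  qed (simp_all (no_asm))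
  let ?W = "Seq (While ?b ?body) (While (Less (var ''pow'') NumVerts)
       (Seq (assign ''pow'' (Plus (var ''pow'') (var ''pow'')))
       (Seq (incr ''run'') (Seq (assign ''f'' (Const 0))
       (While (Less (var ''f'') (var ''best'')) flow_round)))))"
  have "wp R B S ?W final s3 (t - 6) p"
  proof (rule wp_Seq, goal_cases)
    case 1
    show ?case using t by simp
  next
    case 2
    show ?case
    proof (rule runs_wp[OF M])
      show "Suc 3 * Suc K \<le> t - 6 - 1" using t by simp
      fix s t' assume "\<exists>i. I i s \<and> \<not> bval R B s ?b" and t': "t - 6 - 1 \<le> t' + Suc 3 * Suc K"
      then obtain i where I: "I i s" and b: "\<not> bval R B s ?b" by blast
      have fr: "\<And>y. y \<notin> {''i'', ''M''} \<Longrightarrow> s y = s3 y" using I unfolding I_def by blast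
      have "s ''i'' 0 = K" using I b by (auto simp: I_def s3)
      then have "s ''M'' 0 = M" using I by (simp add: I_def algebra_simps)
      then have "env s" by (simp add: env_def fr s3 s0)
      moreover have "outset s = {}" by (simp add: outset_def fr s3 s0)
      moreover have "S = {}" if "n = 0" using S_props(3) that by simp
      moreover have "run_time * L + 1 \<le> t'" using t t' by simp
      moreover have "\<kappa> < K" using bd by simp
      ultimately have "outer_inv L s t' p"
        unfolding outer_inv_def using p by (intro conjI exI[of _ 0]) (auto simp: fr s3)
      then show "wp R B S (While (Less (var ''pow'') NumVerts)
       (Seq (assign ''pow'' (Plus (var ''pow'') (var ''pow'')))
       (Seq (incr ''run'') (Seq (assign ''f'' (Const 0))
       (While (Less (var ''f'') (var ''best'')) flow_round))))) final s t' p"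
        by (rule wp_runs) (rule L)
    qed
  qed
  then have "wp R B S (assign ''pow'' (Const 1)) (wp R B S ?W final) s2 (t - 5) p"
    by (intro wp_Assign) (use t in \<open>simp_all add: s3_def\<close>)
  then have "wp R B S (Seq (assign ''pow'' (Const 1)) ?W) final s2 (t - 4) p"
    by (intro wp_Seq) (use t in simp_all)
  then have "wp R B S (assign ''best'' (var ''k''))
      (wp R B S (Seq (assign ''pow'' (Const 1)) ?W) final) s1 (t - 3) p"
    by (intro wp_Assign) (use t in \<open>simp_all add: s2_def\<close>)
  then have "wp R B S (Seq (assign ''best'' (var ''k'')) (Seq (assign ''pow'' (Const 1)) ?W)) final
      s1 (t - 2) p"
    by (intro wp_Seq) (use t in simp_all)
  then have "wp R B S (assign ''k'' (Plus (var ''c'') (Const 1)))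
      (wp R B S (Seq (assign ''best'' (var ''k'')) (Seq (assign ''pow'' (Const 1)) ?W)) final)
      s0 (t - 1) p"
    by (intro wp_Assign) (use t in \<open>simp_all add: s1_def numeral_2_eq_2\<close>)
  then show ?thesis
    unfolding LocalMinCut_def s0_def[symmetric] by (intro wp_Seq) (use t in simp_all)
qed

lemma success:
  assumes t: "20 + 4 * Suc K + run_time * L \<le> t" and p: "p \<le> 1" "n \<noteq> 0 \<Longrightarrow> p \<le> 1 - 1 / 2 ^ L"
    and L: "\<And>j. 2 ^ j < n \<longleftrightarrow> j < L"
  shows "p \<le> success_prob LocalMinCut R B xs \<nu> c t S"
proof -
  have "p' \<le> win R B S t' ([], s')" if "final s' t' p'" for s' t' p'
    using that win_halted[of S s'] win_nonneg[of R B S t' "([], s')"]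
    by (auto simp: final_def outset_def)
  then have "p \<le> win R B S t ([LocalMinCut], init_store xs \<nu> c)"
    using wp_LocalMinCut[OF assms] unfolding wp_def by blast
  then show ?thesis by (simp add: success_prob_def win_def)
qed

section \<open>Running time\<close>

text \<open>Since \<open>A \<subseteq> S\<close>, every non-isolated vertex of \<open>A\<close>
  contributes at least 1 to the volume of \<open>S\<close>.\<close>

lemma length_xs_le: "length xs \<le> \<nu> + card {v \<in> A. deg G v = 0}"
proof -
  have A: "finite A" using S_props(1,4) by (rule finite_subset)
  have "length xs = card A" using xs distinct_card by metis
  also have "\<dots> = card {v \<in> A. deg G v \<noteq> 0} + card {v \<in> A. deg G v = 0}"
    using A by (subst card_Un_disjoint[symmetric]) (auto intro: arg_cong[where f = card])
  also have "card {v \<in> A. deg G v \<noteq> 0} = (\<Sum>v\<in>{v \<in> A. deg G v \<noteq> 0}. 1)" by simp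
  also have "\<dots> \<le> (\<Sum>v\<in>{v \<in> A. deg G v \<noteq> 0}. deg G v)" by (rule sum_mono) auto
  also have "\<dots> \<le> vol G S"
    unfolding vol_def using S_props by (intro sum_mono2) auto
  finally show ?thesis using vol by simp
qed

text \<open>A round takes time proportional to \<open>C * N\<close> and a run has at most
  \<open>K\<close> rounds, which gives \<open>C * C * N\<close> per run; the cubic bound in
  \<open>C\<close> absorbs this.\<close>

lemma time_le:
  assumes L: "real L \<le> 2 * max 1 (log 2 (real n))"
  shows "real (20 + 4 * Suc K + run_time * L) \<le> 40000 * time_bound G A \<nu> c"
proof -
  define N where "N = max 1 (\<nu> + card {v \<in> A. deg G v = 0})"
  define C where "C = max 1 c"
  define l where "l = max 1 (log 2 (real n))"
  have N: "1 \<le> N" "Suc \<nu> \<le> 2 * N" "length xs \<le> N"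
  proof -
    show "1 \<le> N" "length xs \<le> N" using length_xs_le by (simp_all add: N_def le_max_iff_disj)
    have "\<nu> \<le> N" by (simp add: N_def le_max_iff_disj)
    with \<open>1 \<le> N\<close> show "Suc \<nu> \<le> 2 * N" by linarith
  qed
  have C: "1 \<le> C" "K \<le> 2 * C" by (auto simp: C_def)
  have CN: "1 \<le> C * N" "N \<le> C * N" "C \<le> C * C" using N C by auto
  have CCN: "1 \<le> C * C * N" "C \<le> C * C * N" "C * C * N \<le> C ^ 3 * N"
    using C N by (auto simp: power3_eq_cube)
  have "K * Suc \<nu> \<le> (2 * C) * (2 * N)" using C N by (intro mult_le_mono)
  \<comment> \<open>Here \<open>2 * M = 8 * K * Suc \<nu>\<close> is at most
    \<open>32 * (C * N)\<close>, and the roots and the successor add at most \<open>C * N\<close>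
    each.\<close>
  then have "D \<le> 34 * (C * N)" unfolding D_def using CN N(3) by linarith
  then have "200 * D * K \<le> 200 * (34 * (C * N)) * (2 * C)" using C by (intro mult_le_mono) auto
  also have "\<dots> = 13600 * (C * C * N)" by simp
  finally have rt: "run_time \<le> 13620 * (C * C * N)"
    unfolding run_time_def using CCN(1) by linarith
  have l: "1 \<le> l" by (simp add: l_def)
  have "real (run_time * L) \<le> real (13620 * (C * C * N)) * (2 * l)"
    unfolding of_nat_mult[of run_time] using of_nat_mono[OF rt] L by (intro mult_mono) (simp_all add: l_def)
  also have "\<dots> = 27240 * (real (C * C * N) * l)" by simp
  finally have a: "real (run_time * L) \<le> 27240 * (real (C * C * N) * l)" .
  have "20 + 4 * Suc K \<le> 60 * X" if "1 \<le> X" "C \<le> X" for X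
    using C that by simp
  then have "20 + 4 * Suc K \<le> 60 * (C * C * N)" using CCN(1,2) by blast
  then have "real (20 + 4 * Suc K) \<le> real (60 * (C * C * N))" by (rule of_nat_mono)
  also have "\<dots> \<le> 60 * (real (C * C * N) * l)"
    using mult_left_mono[OF l, of "real (C * C * N)"] by simp
  finally have "real (20 + 4 * Suc K + run_time * L) \<le> 27300 * (real (C * C * N) * l)"
    using a by simp
  also have "\<dots> \<le> 40000 * (real (C ^ 3 * N) * l)"
    using CCN l by (intro mult_mono mult_right_mono of_nat_mono) auto
  also have "\<dots> = 40000 * time_bound G A \<nu> c"
    by (simp add: time_bound_def N_def C_def l_def verts_eq)
  finally show ?thesis .
qed

end

theorem theorem24:
  "\<exists>(LocalMinCut :: com) (K :: real) (\<delta> :: real). K > 0 \<and> \<delta> > 0 \<and>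
     (\<forall>(G :: nat hypergraph) (R :: hg_access) (A :: nat set) (B :: nat set) (xs :: nat list)
        (S :: nat set) (\<nu> :: nat) (c :: nat).
        wf_hypergraph G \<longrightarrow> represents R G \<longrightarrow>
        A \<subseteq> verts G \<longrightarrow> B \<subseteq> verts G \<longrightarrow> A \<inter> B = {} \<longrightarrow>
        distinct xs \<longrightarrow> set xs = A \<longrightarrow>
        is_minimal_mincut G A B S \<longrightarrow>
        size (boundary G S) \<le> c \<longrightarrow> vol G S \<le> \<nu> \<longrightarrow>
        success_prob LocalMinCut R B xs \<nu> c (nat \<lfloor>K * time_bound G A \<nu> c\<rfloor>) S
          \<ge> 1 - real (card (verts G)) powr (- \<delta>))"
proof (intro exI conjI allI impI)
  show "(40000 :: real) > 0" "(1 :: real) > 0" by simp_all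
  fix G R A B xs S \<nu> c
  assume "wf_hypergraph G" "represents R G" "A \<subseteq> verts G" "B \<subseteq> verts G" "A \<inter> B = {}"
    "distinct xs" "set xs = A" "is_minimal_mincut G A B S" "size (boundary G S) \<le> c" "vol G S \<le> \<nu>"
  then interpret local_cut G R A B S xs \<nu> c by unfold_locales
  \<comment> \<open>\<open>L\<close> is the number of runs, the binary logarithm of \<open>n\<close>
    rounded up. Their joint failure probability \<open>1 / 2 ^ L\<close> is at most
    \<open>1 / n\<close>, which is why the exponent 1 is available.\<close>
  define L where "L = (LEAST L. n \<le> 2 ^ L)"
  have nL: "n \<le> 2 ^ L" unfolding L_def by (rule LeastI[of _ n]) (simp add: less_imp_le)
  have L: "2 ^ j < n \<longleftrightarrow> j < L" for j
  proof
    assume "2 ^ j < n"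
    then have "(2::nat) ^ j < 2 ^ L" using nL by linarith
    then show "j < L" by simp
  next
    assume "j < L"
    then show "2 ^ j < n" unfolding L_def using not_less_Least by (metis not_le)
  qed
  have lt: "real L \<le> 2 * max 1 (log 2 (real n))"
  proof (cases L)
    case (Suc j)
    then have "2 ^ j < n" using L by simp
    then have "real (2 ^ j) < real n" by (simp only: of_nat_less_iff)
    then have "log 2 (2 ^ j) < log 2 (real n)" by (intro log_less) auto
    then have "real j < log 2 (real n)" by simp
    then show ?thesis using Suc by simp
  qed simp
  have t: "20 + 4 * Suc K + run_time * L \<le> nat \<lfloor>40000 * time_bound G A \<nu> c\<rfloor>"
    using time_le[OF lt] by (simp only: le_nat_floor)
  show "1 - real (card (verts G)) powr (- 1)
      \<le> success_prob LocalMinCut R B xs \<nu> c (nat \<lfloor>40000 * time_bound G A \<nu> c\<rfloor>) S"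
  proof (rule success[OF t _ _ L])
    show "1 - real (card (verts G)) powr (- 1) \<le> 1" by simp
    assume n: "n \<noteq> 0"
    have "1 / 2 ^ L \<le> 1 / real n"
      using n nL by (intro divide_left_mono) (auto simp flip: of_nat_le_iff)
    then show "1 - real (card (verts G)) powr (- 1) \<le> 1 - 1 / 2 ^ L"
      using n by (simp add: verts_eq powr_minus_divide)
  qed
qed

end
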